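(* Consider the Kepler–Coulomb problem in the Euclidean plane with mass factor $m\in\mathbb{R}\setminus\{0\}$ (of either sign) and center $Z$, and let the wall of reflection be either (i) a circle $\mathcal{C}$ centered at $Z$, or (ii) an arbitrary line $\mathcal{L}$ in the plane (possibly containing $Z$). Consider the billiard system whose dynamics takes place on either one of the two sides of the wall: the particle moves according to the Kepler–Coulomb problem on the chosen side and is reflected at the wall by the usual elastic law of reflection. Then this billiard system is integrable: there exists a spherical Kepler–Coulomb system on an open hemisphere which is in correspondence with the planar Kepler–Coulomb problem and whose energy $E_{sph}$, expressed as a function on the phase space of the planar problem, is together with the planar energy $E_{pl}$ a pair of functionally independent conserved quantities of the billiard system (both are constant along the Kepler–Coulomb motion and are preserved by the reflections at the wall).
   Context: **Planar Kepler–Coulomb problem.** With mass factor $m\neq 0$ and center $Z\in\mathbb{R}^2$: the system $\ddot q=-m\|q-Z\|^{-3}(q-Z)$ on $\mathbb{R}^2\setminus\{Z\}$, with force function (negative of the potential) $U=m\|q-Z\|^{-1}$ and energy $E_{pl}=\tfrac12\|\dot q\|^2-m\|q-Z\|^{-1}$. It is attractive for $m>0$ and repulsive for $m<0$. **Spherical Kepler–Coulomb problem.** On an open hemisphere $H$ of the unit sphere $S\subset\mathbb{R}^3$ with mass factor $m'$ and center $Z_1\in H$: the mechanical system $\nabla_{\dot q}\dot q=\mathrm{grad}\,U$ on $H\setminus\{Z_1\}$ with the round metric and force function $U=m'\cot\theta$, where $\theta$ is the angle between $q$ and $Z_1$. Its energy is $\tfrac12\|\dot q\|^2-m'\cot\theta$.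 **Correspondence.** A mechanical system $(M,g,U)$ is a Riemannian manifold $(M,g)$ with a force function $U$, with equations of motion $\nabla_{\dot q}\dot q=\mathrm{grad}\,U$ and energy $\tfrac12 g(\dot q,\dot q)-U$. Two mechanical systems $(M_1,g_1,U_1)$, $(M_2,g_2,U_2)$ are in correspondence if there is a diffeomorphism $\phi:M_1\to M_2$ mapping unparametrized orbits of the first system to unparametrized orbits of the second and vice versa. If $a(t)$ is an orbit of the first system with $(a(0),\dot a(0))=(x,v)$ and $b(t)=\phi(a(t))$, there is a time change $\tau\mapsto t(\tau)$ such that $b(t(\tau))$ is an orbit of the second system; let $f=dt/d\tau$. The energy of the second system is then expressed as a function on $TM_1$ by $(x,v)\mapsto \tfrac12 g_2(\phi(x))(f\phi_*v,f\phi_*v)-U_2(\phi(x))$. **Billiard conventions.** At the wall, the velocity component normal to the wall changes sign and the tangential component is unchanged (with respect to the Euclidean metric of the plane). Not every orbit starting at the wall needs to return to it; the billiard map may be only partially defined. Orbits running into a collision with $Z$ (in the attractive case) are continued by elastic bouncing (Levi-Civita regularization): after the collision the particle is ejected back along the same ray with the same energy. If the wall contains $Z$, one may alternatively remove $Z$ from the wall and consider only the remaining, non-collisional orbits. **Integrability.** A billiard system is called integrable when there exist two functionally independent conserved quantities (their differentials are linearly independent on a dense open subset of the phase space). *)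

theory Defs
  imports "HOL-Analysis.Analysis"
begin

section \<open>Smooth maps\<close>

text \<open>Iterated differentiability is phrased through directional derivatives, so that all
  derivatives of a map have the type of the map itself. The set is meant to be open.\<close>

fun Ck_on :: "nat \<Rightarrow> ('a::euclidean_space \<Rightarrow> 'b::euclidean_space) \<Rightarrow> 'a set \<Rightarrow> bool" where
  "Ck_on 0 f S \<longleftrightarrow> continuous_on S f"
| "Ck_on (Suc k) f S \<longleftrightarrow>
     (\<forall>x\<in>S. f differentiable (at x)) \<and> (\<forall>v. Ck_on k (\<lambda>x. frechet_derivative f (at x) v) S)"

text \<open>Smoothness on an arbitrary subset, in particular on a submanifold: locally, the map is the
  restriction of a smooth map of the ambient space.\<close>

definition smooth_on :: "'a::euclidean_space set \<Rightarrow> ('a \<Rightarrow> 'b::euclidean_space) \<Rightarrow> bool" where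
  "smooth_on S f \<longleftrightarrow>
     (\<forall>x\<in>S. \<exists>V g. open V \<and> x \<in> V \<and> (\<forall>k. Ck_on k g V) \<and> (\<forall>y\<in>S \<inter> V. g y = f y))"

definition diffeomorphism ::
    "('a::euclidean_space \<Rightarrow> 'b::euclidean_space) \<Rightarrow> 'a set \<Rightarrow> 'b set \<Rightarrow> bool" where
  "diffeomorphism \<phi> M N \<longleftrightarrow>
     bij_betw \<phi> M N \<and> smooth_on M \<phi> \<and> smooth_on N (inv_into M \<phi>)"


section \<open>Mechanical systems\<close>

text \<open>A mechanical system is given by a submanifold \<open>M\<close> of a Euclidean space, with the induced
  Riemannian metric, and a force function \<open>U\<close>, of which only the values on \<open>M\<close> matter. The
  Levi-Civita derivative of the velocity is then the orthogonal projection of the ambient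
  acceleration to the tangent space.\<close>

definition curve_through ::
    "'a::euclidean_space set \<Rightarrow> 'a \<Rightarrow> 'a \<Rightarrow> (real \<Rightarrow> 'a) \<Rightarrow> bool" where
  "curve_through M x w \<gamma> \<longleftrightarrow>
     \<gamma> 0 = x \<and> (\<exists>\<epsilon>>0. \<forall>s. \<bar>s\<bar> < \<epsilon> \<longrightarrow> \<gamma> s \<in> M) \<and> (\<gamma> has_vector_derivative w) (at 0)"

definition tangent_space :: "'a::euclidean_space set \<Rightarrow> 'a \<Rightarrow> 'a set" where
  "tangent_space M x = {w. \<exists>\<gamma>. curve_through M x w \<gamma>}"

definition tangent_bundle :: "'a::euclidean_space set \<Rightarrow> ('a \<times> 'a) set" where
  "tangent_bundle M = {(x, v). x \<in> M \<and> v \<in> tangent_space M x}"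

definition tangential_part :: "'a::euclidean_space set \<Rightarrow> 'a \<Rightarrow> 'a \<Rightarrow> 'a" where
  "tangential_part M x u =
     (THE p. p \<in> tangent_space M x \<and> (\<forall>w\<in>tangent_space M x. (u - p) \<bullet> w = 0))"

definition riemannian_grad ::
    "'a::euclidean_space set \<Rightarrow> ('a \<Rightarrow> real) \<Rightarrow> 'a \<Rightarrow> 'a" where
  "riemannian_grad M U x =
     (THE p. p \<in> tangent_space M x \<and>
        (\<forall>w \<gamma>. curve_through M x w \<gamma> \<longrightarrow> ((\<lambda>s. U (\<gamma> s)) has_real_derivative p \<bullet> w) (at 0)))"

definition velocity :: "(real \<Rightarrow> 'a::euclidean_space) \<Rightarrow> real \<Rightarrow> 'a" where
  "velocity q t = vector_derivative q (at t)"

definition covariant_acceleration ::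
    "'a::euclidean_space set \<Rightarrow> (real \<Rightarrow> 'a) \<Rightarrow> real \<Rightarrow> 'a" where
  "covariant_acceleration M q t = tangential_part M (q t) (velocity (velocity q) t)"

definition obeys_motion ::
    "'a::euclidean_space set \<Rightarrow> ('a \<Rightarrow> real) \<Rightarrow> (real \<Rightarrow> 'a) \<Rightarrow> real \<Rightarrow> bool" where
  "obeys_motion M U q t \<longleftrightarrow>
     q t \<in> M \<and> q differentiable (at t) \<and> velocity q differentiable (at t) \<and>
     covariant_acceleration M q t = riemannian_grad M U (q t)"

definition open_interval :: "real set \<Rightarrow> bool" where
  "open_interval J \<longleftrightarrow> open J \<and> is_interval J \<and> J \<noteq> {}"

definition orbit ::
    "'a::euclidean_space set \<Rightarrow> ('a \<Rightarrow> real) \<Rightarrow> (real \<Rightarrow> 'a) \<Rightarrow> real set \<Rightarrow> bool" where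
  "orbit M U q J \<longleftrightarrow> open_interval J \<and> (\<forall>t\<in>J. obeys_motion M U q t)"

definition mech_energy :: "('a::euclidean_space \<Rightarrow> real) \<Rightarrow> 'a \<times> 'a \<Rightarrow> real" where
  "mech_energy U = (\<lambda>(x, v). (v \<bullet> v) / 2 - U x)"


section \<open>Correspondence of mechanical systems\<close>

definition time_change :: "(real \<Rightarrow> real) \<Rightarrow> real set \<Rightarrow> real set \<Rightarrow> bool" where
  "time_change t K J \<longleftrightarrow> open_interval K \<and> open_interval J \<and> bij_betw t K J \<and>
     (\<forall>\<tau>\<in>K. \<exists>d>0. (t has_real_derivative d) (at \<tau>))"

text \<open>The function \<open>f\<close> on the tangent bundle of the first system is the rate \<open>dt/d\<tau>\<close> of the time
  change. It is carried along explicitly because a single unparametrized orbit of the second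
  system may underlie motions of different energies (rays through the centre, for instance), so
  that \<open>f\<close> is not determined orbit by orbit; smoothness removes this ambiguity.\<close>

definition correspondence ::
    "'a::euclidean_space set \<Rightarrow> ('a \<Rightarrow> real) \<Rightarrow> 'b::euclidean_space set \<Rightarrow> ('b \<Rightarrow> real) \<Rightarrow>
     ('a \<Rightarrow> 'b) \<Rightarrow> ('a \<times> 'a \<Rightarrow> real) \<Rightarrow> bool" where
  "correspondence M\<^sub>1 U\<^sub>1 M\<^sub>2 U\<^sub>2 \<phi> f \<longleftrightarrow>
     diffeomorphism \<phi> M\<^sub>1 M\<^sub>2 \<and>
     smooth_on (tangent_bundle M\<^sub>1) f \<and> (\<forall>p\<in>tangent_bundle M\<^sub>1. f p > 0) \<and>
     (\<forall>a J. orbit M\<^sub>1 U\<^sub>1 a J \<longrightarrow>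
        (\<exists>t K. time_change t K J \<and> orbit M\<^sub>2 U\<^sub>2 (\<phi> \<circ> a \<circ> t) K \<and>
           (\<forall>\<tau>\<in>K. (t has_real_derivative f (a (t \<tau>), velocity a (t \<tau>))) (at \<tau>)))) \<and>
     (\<forall>b K. orbit M\<^sub>2 U\<^sub>2 b K \<longrightarrow>
        (\<exists>s J. time_change s J K \<and> orbit M\<^sub>1 U\<^sub>1 (inv_into M\<^sub>1 \<phi> \<circ> b \<circ> s) J))"

text \<open>The energy of the second system as a function on the phase space of the first one. The
  first configuration space is assumed to be open in its Euclidean space, so that \<open>\<phi>\<close> has an
  ordinary derivative.\<close>

definition transported_energy ::
    "('b::euclidean_space \<Rightarrow> real) \<Rightarrow> ('a::euclidean_space \<Rightarrow> 'b) \<Rightarrow> ('a \<times> 'a \<Rightarrow> real) \<Rightarrow>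
     'a \<times> 'a \<Rightarrow> real" where
  "transported_energy U\<^sub>2 \<phi> f =
     (\<lambda>(x, v). mech_energy U\<^sub>2 (\<phi> x, f (x, v) *\<^sub>R frechet_derivative \<phi> (at x) v))"


section \<open>Kepler--Coulomb problems\<close>

definition planar_kepler_U :: "real \<Rightarrow> real^2 \<Rightarrow> real^2 \<Rightarrow> real" where
  "planar_kepler_U m Z q = m / norm (q - Z)"

definition open_hemisphere :: "real^3 \<Rightarrow> (real^3) set" where
  "open_hemisphere N = {u. norm u = 1 \<and> N \<bullet> u > 0}"

text \<open>For unit vectors, \<open>arccos (u \<bullet> Z\<^sub>1)\<close> is the angle between \<open>u\<close> and \<open>Z\<^sub>1\<close>.\<close>

definition spherical_kepler_U :: "real \<Rightarrow> real^3 \<Rightarrow> real^3 \<Rightarrow> real" where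
  "spherical_kepler_U m' Z\<^sub>1 u = m' * cot (arccos (u \<bullet> Z\<^sub>1))"


section \<open>Billiards\<close>

text \<open>\<open>kepler_table Z W \<nu> \<Omega>\<close>: \<open>W\<close> is an admissible wall, \<open>\<nu>\<close> a normal vector field along it, and
  \<open>\<Omega>\<close> one of the two sides of the wall.\<close>

inductive kepler_table ::
    "real^2 \<Rightarrow> (real^2) set \<Rightarrow> (real^2 \<Rightarrow> real^2) \<Rightarrow> (real^2) set \<Rightarrow> bool" for Z where
  circle_inside: "R > 0 \<Longrightarrow> kepler_table Z (sphere Z R) (\<lambda>q. q - Z) (ball Z R)"
| circle_outside: "R > 0 \<Longrightarrow> kepler_table Z (sphere Z R) (\<lambda>q. q - Z) (- cball Z R)"
| line_below: "n \<noteq> 0 \<Longrightarrow> kepler_table Z {q. n \<bullet> q = c} (\<lambda>_. n) {q. n \<bullet> q < c}"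
| line_above: "n \<noteq> 0 \<Longrightarrow> kepler_table Z {q. n \<bullet> q = c} (\<lambda>_. n) {q. n \<bullet> q > c}"

definition reflect :: "real^2 \<Rightarrow> real^2 \<Rightarrow> real^2" where
  "reflect n v = v - (2 * (v \<bullet> n) / (n \<bullet> n)) *\<^sub>R n"

definition wall_reflection ::
    "(real^2) set \<Rightarrow> (real^2 \<Rightarrow> real^2) \<Rightarrow> (real \<Rightarrow> real^2) \<Rightarrow> real \<Rightarrow> bool" where
  "wall_reflection W \<nu> q t \<longleftrightarrow> q t \<in> W \<and>
     (\<exists>v. (velocity q \<longlongrightarrow> v) (at_left t) \<and> (velocity q \<longlongrightarrow> reflect (\<nu> (q t)) v) (at_right t))"

text \<open>Regularized collision with \<open>Z\<close> at time \<open>t\<close>: just before and just after \<open>t\<close> the particle is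
  on the same ray from \<open>Z\<close> and has the same energy.\<close>

definition collision_bounce :: "real \<Rightarrow> real^2 \<Rightarrow> (real \<Rightarrow> real^2) \<Rightarrow> real \<Rightarrow> bool" where
  "collision_bounce m Z q t \<longleftrightarrow> q t = Z \<and>
     (\<exists>e h. norm e = 1 \<and>
        (\<forall>\<^sub>F s in at t. (\<exists>r>0. q s = Z + r *\<^sub>R e) \<and>
           mech_energy (planar_kepler_U m Z) (q s, velocity q s) = h))"

text \<open>A billiard trajectory on the time interval \<open>J\<close>; \<open>T\<close> is the set of times of reflections at
  the wall and of collisions with \<open>Z\<close>, which does not accumulate in \<open>J\<close>. If the wall contains
  \<open>Z\<close>, then arriving at \<open>Z\<close> counts as a collision.\<close>

definition billiard_trajectory ::
    "real \<Rightarrow> real^2 \<Rightarrow> (real^2) set \<Rightarrow> (real^2 \<Rightarrow> real^2) \<Rightarrow> (real^2) set \<Rightarrow>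
     (real \<Rightarrow> real^2) \<Rightarrow> real set \<Rightarrow> real set \<Rightarrow> bool" where
  "billiard_trajectory m Z W \<nu> \<Omega> q J T \<longleftrightarrow>
     open_interval J \<and> T \<subseteq> J \<and> T sparse_in J \<and> continuous_on J q \<and>
     (\<forall>t\<in>J - T. obeys_motion (\<Omega> - {Z}) (planar_kepler_U m Z) q t) \<and>
     (\<forall>t\<in>T. wall_reflection (W - {Z}) \<nu> q t \<or> collision_bounce m Z q t)"

text \<open>A conserved quantity is constant along the Kepler--Coulomb motion, is preserved by the
  reflections at the wall, and is constant along whole billiard trajectories, including those
  with collisions.\<close>

definition billiard_conserved ::
    "real \<Rightarrow> real^2 \<Rightarrow> (real^2) set \<Rightarrow> (real^2 \<Rightarrow> real^2) \<Rightarrow> (real^2) set \<Rightarrow>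
     ((real^2) \<times> (real^2) \<Rightarrow> real) \<Rightarrow> bool" where
  "billiard_conserved m Z W \<nu> \<Omega> F \<longleftrightarrow>
     (\<forall>q J. orbit (- {Z}) (planar_kepler_U m Z) q J \<longrightarrow>
        (\<lambda>t. F (q t, velocity q t)) constant_on J) \<and>
     (\<forall>p\<in>W - {Z}. \<forall>v. F (p, reflect (\<nu> p) v) = F (p, v)) \<and>
     (\<forall>q J T. billiard_trajectory m Z W \<nu> \<Omega> q J T \<longrightarrow>
        (\<lambda>t. F (q t, velocity q t)) constant_on (J - T))"

definition functionally_independent_on ::
    "'p::euclidean_space set \<Rightarrow> ('p \<Rightarrow> real) \<Rightarrow> ('p \<Rightarrow> real) \<Rightarrow> bool" where
  "functionally_independent_on P F G \<longleftrightarrow>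
     (\<exists>D. open D \<and> D \<subseteq> P \<and> P \<subseteq> closure D \<and>
        (\<forall>p\<in>D. F differentiable (at p) \<and> G differentiable (at p) \<and>
           (\<forall>a b. (\<forall>h. a * frechet_derivative F (at p) h + b * frechet_derivative G (at p) h = 0)
              \<longrightarrow> a = 0 \<and> b = 0)))"

definition billiard_integrable_by ::
    "real \<Rightarrow> real^2 \<Rightarrow> (real^2) set \<Rightarrow> (real^2 \<Rightarrow> real^2) \<Rightarrow> (real^2) set \<Rightarrow>
     ((real^2) \<times> (real^2) \<Rightarrow> real) \<Rightarrow> ((real^2) \<times> (real^2) \<Rightarrow> real) \<Rightarrow> bool" where
  "billiard_integrable_by m Z W \<nu> \<Omega> F G \<longleftrightarrow>
     billiard_conserved m Z W \<nu> \<Omega> F \<and> billiard_conserved m Z W \<nu> \<Omega> G \<and>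
     functionally_independent_on ((\<Omega> - {Z}) \<times> UNIV) F G"


section \<open>The definitions in the planar and spherical cases\<close>

text \<open>On an open part of the plane the law of motion is the Kepler--Coulomb equation, and on an open
  part of the unit sphere the tangent space at a point is its orthogonal complement.\<close>

lemma tangent_space_open:
  fixes M :: "'a::euclidean_space set"
  assumes "open M" "x \<in> M"
  shows "tangent_space M x = UNIV"
proof -
  have "\<exists>\<gamma>. curve_through M x w \<gamma>" for w
  proof -
    have "((\<lambda>s::real. x + s *\<^sub>R w) \<longlongrightarrow> x + 0 *\<^sub>R w) (at 0)"
      by (intro tendsto_intros)
    then have "\<forall>\<^sub>F s in at (0::real). x + s *\<^sub>R w \<in> M"
      using assms by (auto dest: topological_tendstoD)
    then obtain \<epsilon> where "\<epsilon> > 0" "\<And>s. s \<noteq> 0 \<Longrightarrow> dist s 0 < \<epsilon> \<Longrightarrow> x + s *\<^sub>R w \<in> M"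
      by (auto simp: eventually_at)
    then have "\<exists>\<epsilon>>0. \<forall>s. \<bar>s\<bar> < \<epsilon> \<longrightarrow> x + s *\<^sub>R w \<in> M"
      using assms(2) by (intro exI[of _ \<epsilon>]) (metis add.right_neutral dist_real_def diff_zero scaleR_zero_left)
    moreover have "((\<lambda>s::real. x + s *\<^sub>R w) has_vector_derivative w) (at 0)"
      by (auto intro!: derivative_eq_intros)
    ultimately show ?thesis
      by (intro exI[of _ "\<lambda>s. x + s *\<^sub>R w"]) (auto simp: curve_through_def)
  qed
  then show ?thesis by (auto simp: tangent_space_def)
qed

lemma riemannian_gradI:
  assumes p: "p \<in> tangent_space M x"
    and d: "\<And>w \<gamma>. curve_through M x w \<gamma> \<Longrightarrow> ((\<lambda>s. U (\<gamma> s)) has_real_derivative p \<bullet> w) (at 0)"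
    and sub: "subspace (tangent_space M x)"
  shows "riemannian_grad M U x = p"
  unfolding riemannian_grad_def
proof (rule the_equality)
  show "p \<in> tangent_space M x \<and> (\<forall>w \<gamma>. curve_through M x w \<gamma> \<longrightarrow>
     ((\<lambda>s. U (\<gamma> s)) has_real_derivative p \<bullet> w) (at 0))"
    using p d by blast
next
  fix p'
  assume p': "p' \<in> tangent_space M x \<and> (\<forall>w \<gamma>. curve_through M x w \<gamma> \<longrightarrow>
     ((\<lambda>s. U (\<gamma> s)) has_real_derivative p' \<bullet> w) (at 0))"
  have "p' - p \<in> tangent_space M x" using p p' sub by (simp add: subspace_diff)
  then obtain \<gamma> where "curve_through M x (p' - p) \<gamma>" by (auto simp: tangent_space_def)
  then have "p \<bullet> (p' - p) = p' \<bullet> (p' - p)" using p' d DERIV_unique by blast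
  then have "(p' - p) \<bullet> (p' - p) = 0" by (simp add: inner_diff_left)
  then show "p' = p" by simp
qed

lemma tangential_partI:
  assumes p: "p \<in> tangent_space M x" and d: "\<And>w. w \<in> tangent_space M x \<Longrightarrow> (u - p) \<bullet> w = 0"
    and sub: "subspace (tangent_space M x)"
  shows "tangential_part M x u = p"
  unfolding tangential_part_def
proof (rule the_equality)
  fix p' assume p': "p' \<in> tangent_space M x \<and> (\<forall>w\<in>tangent_space M x. (u - p') \<bullet> w = 0)"
  have "p' - p \<in> tangent_space M x" using p p' sub by (simp add: subspace_diff)
  then have "(u - p) \<bullet> (p' - p) - (u - p') \<bullet> (p' - p) = 0" using p' d by simp
  then have "(p' - p) \<bullet> (p' - p) = 0" by (simp add: inner_diff_left)
  then show "p' = p" by simp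
qed (use p d in auto)

lemma planar_grad:
  assumes "open M" "x \<in> M" "Z \<notin> M"
  shows "riemannian_grad M (planar_kepler_U m Z) x = - (m / norm (x - Z) ^ 3) *\<^sub>R (x - Z)"
proof (rule riemannian_gradI)
  fix w \<gamma> assume c: "curve_through M x w \<gamma>"
  have nz: "norm (x - Z) \<noteq> 0" using assms by auto
  have g: "\<gamma> 0 = x" "(\<gamma> has_vector_derivative w) (at 0)" using c by (auto simp: curve_through_def)
  have i: "((\<lambda>s. (\<gamma> s - Z) \<bullet> (\<gamma> s - Z)) has_real_derivative 2 * ((x - Z) \<bullet> w)) (at 0)"
    unfolding has_real_derivative_iff_has_vector_derivative has_vector_derivative_def
    using g(2)[unfolded has_vector_derivative_def] g(1)
    by (auto intro!: derivative_eq_intros simp: algebra_simps inner_commute)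
  have pos: "(\<gamma> 0 - Z) \<bullet> (\<gamma> 0 - Z) > 0" using nz g by simp
  have n: "((\<lambda>s. norm (\<gamma> s - Z)) has_real_derivative ((x - Z) \<bullet> w) / norm (x - Z)) (at 0)"
    unfolding norm_eq_sqrt_inner using g pos
    using leD[OF inner_ge_zero[of "\<gamma> 0 - Z"]] by (auto intro!: derivative_eq_intros i simp: field_simps)
  have "((\<lambda>s. planar_kepler_U m Z (\<gamma> s)) has_real_derivative
     - (m / norm (x - Z) ^ 3) * ((x - Z) \<bullet> w)) (at 0)"
    unfolding planar_kepler_U_def
    by (rule DERIV_cong[OF DERIV_divide[OF DERIV_const n]])
       (use g nz in \<open>simp_all add: field_simps power3_eq_cube\<close>)
  then show "((\<lambda>s. planar_kepler_U m Z (\<gamma> s)) has_real_derivative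
     (- (m / norm (x - Z) ^ 3) *\<^sub>R (x - Z)) \<bullet> w) (at 0)"
    by (simp only: inner_scaleR_left)
qed (use tangent_space_open[OF assms(1,2)] in auto)

lemma obeys_motion_planar_kepler:
  assumes "open M" "Z \<notin> M"
  shows "obeys_motion M (planar_kepler_U m Z) q t \<longleftrightarrow>
    q t \<in> M \<and> q differentiable (at t) \<and> velocity q differentiable (at t) \<and>
    velocity (velocity q) t = - (m / norm (q t - Z) ^ 3) *\<^sub>R (q t - Z)"
proof -
  have "tangential_part M x u = u" if "x \<in> M" for x u
    by (rule tangential_partI) (auto simp: tangent_space_open[OF assms(1) that])
  then show ?thesis
    unfolding obeys_motion_def covariant_acceleration_def
    using planar_grad[OF assms(1) _ assms(2)] by metis
qed

lemma tangent_space_sphere: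
  assumes S: "openin (top_of_set (sphere 0 1)) M" and x: "x \<in> (M :: 'a::euclidean_space set)"
  shows "tangent_space M x = {w. x \<bullet> w = 0}"
proof (intro equalityI subsetI)
  fix w assume "w \<in> tangent_space M x"
  then obtain \<gamma> \<epsilon> where g: "\<gamma> 0 = x" "\<epsilon> > 0" "\<And>s. \<bar>s\<bar> < \<epsilon> \<Longrightarrow> \<gamma> s \<in> M"
    "(\<gamma> has_vector_derivative w) (at 0)" by (auto simp: tangent_space_def curve_through_def)
  have sub: "M \<subseteq> sphere 0 1" using S by (auto simp: openin_contains_ball)
  have i: "((\<lambda>s. \<gamma> s \<bullet> \<gamma> s) has_real_derivative 2 * (x \<bullet> w)) (at 0)"
    unfolding has_real_derivative_iff_has_vector_derivative has_vector_derivative_def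
    using g(4)[unfolded has_vector_derivative_def] g(1)
    by (auto intro!: derivative_eq_intros simp: algebra_simps inner_commute)
  have "\<gamma> s \<bullet> \<gamma> s = 1" if "\<bar>s\<bar> < \<epsilon>" for s
    using sub g(3)[OF that] by (auto simp: norm_eq_1)
  then have "((\<lambda>s. 1::real) has_real_derivative 2 * (x \<bullet> w)) (at 0)"
    using i by (rule_tac has_field_derivative_transform_within[OF i g(2)]) (auto simp: dist_real_def)
  then show "w \<in> {w. x \<bullet> w = 0}" using DERIV_unique[OF _ DERIV_const] by fastforce
next
  fix w assume "w \<in> {w. x \<bullet> w = 0}"
  then have w: "x \<bullet> w = 0" by simp
  have nx: "norm x = 1" using S x by (auto simp: openin_contains_ball)
  obtain O' where O: "open O'" "M = sphere 0 1 \<inter> O'" using S by (auto simp: openin_open)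
  define \<gamma> where "\<gamma> s = (1 / norm (x + s *\<^sub>R w)) *\<^sub>R (x + s *\<^sub>R w)" for s :: real
  have sq: "(x + s *\<^sub>R w) \<bullet> (x + s *\<^sub>R w) = 1 + s^2 * (w \<bullet> w)" for s
    using nx w by (simp add: inner_add_left inner_add_right norm_eq_1 inner_commute power2_eq_square)
  have no: "norm (x + s *\<^sub>R w) = sqrt (1 + s^2 * (w \<bullet> w))" for s
    by (simp add: norm_eq_sqrt_inner sq)
  have p: "1 + s^2 * (w \<bullet> w) > 0" for s :: real
    by (meson add_pos_nonneg inner_ge_zero mult_nonneg_nonneg zero_le_power2 zero_less_one)
  have d: "(\<gamma> has_vector_derivative w) (at 0)"
  proof -
    have "((\<lambda>s::real. 1 / sqrt (1 + s^2 * (w \<bullet> w))) has_real_derivative 0) (at 0)"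
      by (auto intro!: derivative_eq_intros)
    then have "((\<lambda>s::real. (1 / sqrt (1 + s^2 * (w \<bullet> w))) *\<^sub>R (x + s *\<^sub>R w)) has_vector_derivative
       (1 / sqrt (1 + 0^2 * (w \<bullet> w))) *\<^sub>R w + 0 *\<^sub>R (x + 0 *\<^sub>R w)) (at 0)"
      by (intro has_vector_derivative_scaleR) (auto intro!: derivative_eq_intros)
    then show ?thesis unfolding \<gamma>_def no by simp
  qed
  have g0: "\<gamma> 0 = x" by (simp add: \<gamma>_def nx)
  have "(\<gamma> \<longlongrightarrow> \<gamma> 0) (at 0)" using d has_vector_derivative_continuous isCont_def by blast
  then have "\<forall>\<^sub>F s in at 0. \<gamma> s \<in> O'" using O x g0 by (auto dest: topological_tendstoD)
  then obtain \<epsilon> where e: "\<epsilon> > 0" "\<And>s. s \<noteq> 0 \<Longrightarrow> dist s 0 < \<epsilon> \<Longrightarrow> \<gamma> s \<in> O'"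
    by (auto simp: eventually_at)
  have "norm (\<gamma> s) = 1" for s
    using p[of s] no[of s] by (auto simp: \<gamma>_def)
  then have "\<gamma> s \<in> M" if "\<bar>s\<bar> < \<epsilon>" for s
    using that e(2)[of s] O g0 x by (cases "s = 0") (auto simp: dist_real_def)
  then show "w \<in> tangent_space M x" using g0 d e(1)
    by (auto simp: tangent_space_def curve_through_def)
qed

end

theory Submission
  imports Defs
begin

text \<open>Put \<open>x = q - Z\<close> and let \<open>h\<close> be the foot of the perpendicular dropped from \<open>Z\<close> to the wall,
  relative to \<open>Z\<close> (\<open>h = 0\<close> for a circle). Place the plane affinely in space by
  \<open>x \<mapsto> y = (x, d - h \<bullet> x)\<close> with \<open>d = 1 + h \<bullet> h\<close>, and project it centrally to the unit sphere. With
  the time change \<open>dt/d\<tau> = \<bar>y\<bar>\<^sup>2\<close> this maps planar Kepler orbits to spherical ones with centre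
  \<open>(0, 0, 1)\<close> and mass factor \<open>m d\<close>. The spherical energy becomes \<open>d\<^sup>2 E + d G\<close>, where \<open>E\<close> is the planar
  energy and \<open>G = C\<^sup>2 / 2 - h \<bullet> A\<close> combines the angular momentum \<open>C\<close> with the Laplace vector \<open>A\<close>.
  This tilt of the plane is the one for which the part of \<open>G\<close> that is odd in the normal
  velocity vanishes on the wall.\<close>

text \<open>Orbits go to orbits because \<open>- m x / |x|^3\<close> lifts to
  \<open>- m (y - d pole) / |x|^3\<close>, where \<open>pole\<close> is the vertical unit vector.
  The multiple of \<open>y\<close> is normal to the sphere; what remains acts along the pole, onto
  which \<open>Z\<close> projects.

  The height \<open>d\<close> is forced by the wall. A plane of arbitrary height \<open>k\<close>,
  \<open>x \<mapsto> (x, k - h \<bullet> x)\<close>, would give the spherical energy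
  \<open>k^2 E + (1 + h \<bullet> h) C^2 / 2 - k (h \<bullet> A)\<close>. Reflection at a line whose
  foot relative to \<open>Z\<close> is \<open>p\<close> preserves
  \<open>C^2 / 2 - p \<bullet> A\<close>, so \<open>k h = (1 + h \<bullet> h) p\<close> is wanted.
  With \<open>k = 1\<close> this has no solution once \<open>|p| > 1/2\<close>; with
  \<open>k = 1 + h \<bullet> h\<close> it just says \<open>h = p\<close>, for every line.

  The wall enters only through \<open>h\<close>: the correspondence and the conservation along
  orbits hold for all \<open>h\<close>, and the choice of side matters only through openness. At a
  collision \<open>C\<close> vanishes along the ray, and \<open>G\<close> reduces to a function of
  its direction.\<close>

section \<open>Smoothness of elementary functions\<close>

text \<open>A class closed under directional derivatives, so that one induction yields all orders of
  \<open>Ck_on\<close>. Norms enter as square roots of positive polynomials. The rule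
  \<open>elementary_cong\<close> is there because derivatives are known by formula only on
  \<open>S\<close>.\<close>

inductive elementary_on :: "'a::euclidean_space set \<Rightarrow> ('a \<Rightarrow> real) \<Rightarrow> bool" for S where
  elementary_const: "elementary_on S (\<lambda>x. c)"
| elementary_linear: "bounded_linear f \<Longrightarrow> elementary_on S f"
| elementary_add: "elementary_on S f \<Longrightarrow> elementary_on S g \<Longrightarrow> elementary_on S (\<lambda>x. f x + g x)"
| elementary_mult: "elementary_on S f \<Longrightarrow> elementary_on S g \<Longrightarrow> elementary_on S (\<lambda>x. f x * g x)"
| elementary_inverse:
    "elementary_on S f \<Longrightarrow> (\<And>x. x \<in> S \<Longrightarrow> f x \<noteq> 0) \<Longrightarrow> elementary_on S (\<lambda>x. inverse (f x))"
| elementary_sqrt: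
    "elementary_on S f \<Longrightarrow> (\<And>x. x \<in> S \<Longrightarrow> f x > 0) \<Longrightarrow> elementary_on S (\<lambda>x. sqrt (f x))"
| elementary_cong:
    "elementary_on S f \<Longrightarrow> (\<And>x. x \<in> S \<Longrightarrow> f x = g x) \<Longrightarrow> elementary_on S g"

text \<open>The derivative of each formation rule is again built from the rules. Openness of
  \<open>S\<close> lets equality on \<open>S\<close> pass to derivatives in the case
  \<open>elementary_cong\<close>.\<close>

lemma elementary_on_has_derivative:
  assumes "elementary_on S f" "open S"
  shows "\<exists>f'. (\<forall>x\<in>S. (f has_derivative f' x) (at x)) \<and> (\<forall>v. elementary_on S (\<lambda>x. f' x v))"
  using assms(1)
proof induction
  case (elementary_const c)
  show ?case
    by (intro exI[of _ "\<lambda>x v. 0"]) (auto intro!: derivative_eq_intros elementary_on.elementary_const)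
next
  case (elementary_linear f)
  then show ?case
    by (intro exI[of _ "\<lambda>x. f"])
       (auto intro: bounded_linear_imp_has_derivative elementary_on.elementary_const)
next
  case (elementary_add f g)
  then obtain f' g' where
    "\<forall>x\<in>S. (f has_derivative f' x) (at x)" "\<forall>v. elementary_on S (\<lambda>x. f' x v)"
    "\<forall>x\<in>S. (g has_derivative g' x) (at x)" "\<forall>v. elementary_on S (\<lambda>x. g' x v)" by blast
  then show ?case
    by (intro exI[of _ "\<lambda>x v. f' x v + g' x v"])
       (auto intro!: has_derivative_add elementary_on.elementary_add)
next
  case (elementary_mult f g)
  then obtain f' g' where
    "\<forall>x\<in>S. (f has_derivative f' x) (at x)" "\<forall>v. elementary_on S (\<lambda>x. f' x v)"
    "\<forall>x\<in>S. (g has_derivative g' x) (at x)" "\<forall>v. elementary_on S (\<lambda>x. g' x v)" by blast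
  then show ?case using elementary_mult.hyps
    by (intro exI[of _ "\<lambda>x v. f x * g' x v + f' x v * g x"])
       (auto intro!: has_derivative_mult elementary_on.elementary_add elementary_on.elementary_mult)
next
  case (elementary_inverse f)
  then obtain f' where
    f': "\<forall>x\<in>S. (f has_derivative f' x) (at x)" "\<forall>v. elementary_on S (\<lambda>x. f' x v)" by blast
  have inv: "elementary_on S (\<lambda>x. inverse (f x))"
    using elementary_inverse by (blast intro: elementary_on.elementary_inverse)
  have "((\<lambda>x. inverse (f x)) has_derivative (\<lambda>v. (-1) * (inverse (f x) * f' x v * inverse (f x)))) (at x)"
    if "x \<in> S" for x
    using Deriv.has_derivative_inverse[OF elementary_inverse.hyps(2)[OF that] bspec[OF f'(1) that]] by simp
  moreover have "elementary_on S (\<lambda>x. (-1) * (inverse (f x) * f' x v * inverse (f x)))" for v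
    by (rule elementary_on.elementary_mult[OF elementary_on.elementary_const
         elementary_on.elementary_mult[OF elementary_on.elementary_mult[OF inv spec[OF f'(2)]] inv]])
  ultimately show ?case by (intro exI conjI ballI allI)
next
  case (elementary_sqrt f)
  then obtain f' where
    f': "\<forall>x\<in>S. (f has_derivative f' x) (at x)" "\<forall>v. elementary_on S (\<lambda>x. f' x v)" by blast
  have sq: "elementary_on S (\<lambda>x. inverse (sqrt (f x)))"
    using elementary_sqrt by (force intro: elementary_on.elementary_inverse elementary_on.elementary_sqrt)
  have "((\<lambda>x. sqrt (f x)) has_derivative (\<lambda>v. 1 / 2 * (inverse (sqrt (f x)) * f' x v))) (at x)"
    if "x \<in> S" for x
  proof -
    have "(sqrt has_derivative (*) (inverse (sqrt (f x)) / 2)) (at (f x))"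
      using elementary_sqrt.hyps(2)[OF that] DERIV_real_sqrt[of "f x"] by (simp add: has_field_derivative_def)
    from has_derivative_compose[OF bspec[OF f'(1) that] this] show ?thesis
      by (simp add: mult_ac)
  qed
  moreover have "elementary_on S (\<lambda>x. 1 / 2 * (inverse (sqrt (f x)) * f' x v))" for v
    by (rule elementary_on.elementary_mult[OF elementary_on.elementary_const
         elementary_on.elementary_mult[OF sq spec[OF f'(2)]]])
  ultimately show ?case by (intro exI conjI ballI allI)
next
  case (elementary_cong f g)
  then obtain f' where
    f': "\<forall>x\<in>S. (f has_derivative f' x) (at x)" "\<forall>v. elementary_on S (\<lambda>x. f' x v)" by blast
  have "(g has_derivative f' x) (at x)" if "x \<in> S" for x
    using has_derivative_transform_within_open[OF bspec[OF f'(1) that] assms(2) that] elementary_cong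
    by blast
  then show ?case using f' by blast
qed

lemma elementary_onD:
  assumes "elementary_on S f" "open S"
  shows "x \<in> S \<Longrightarrow> f differentiable (at x)"
    and "elementary_on S (\<lambda>x. frechet_derivative f (at x) v)"
proof -
  obtain f' where f': "\<forall>x\<in>S. (f has_derivative f' x) (at x)" "\<forall>v. elementary_on S (\<lambda>x. f' x v)"
    using elementary_on_has_derivative[OF assms] by blast
  then show "x \<in> S \<Longrightarrow> f differentiable (at x)" by (auto simp: differentiable_def)
  show "elementary_on S (\<lambda>x. frechet_derivative f (at x) v)"
  proof (rule elementary_cong)
    show "elementary_on S (\<lambda>x. f' x v)" using f' by blast
    show "f' x v = frechet_derivative f (at x) v" if "x \<in> S" for x
      using fun_cong[OF frechet_derivative_at[OF bspec[OF f'(1) that]], of v] .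
  qed
qed

lemma elementary_diff:
  assumes "elementary_on S f" "elementary_on S g"
  shows "elementary_on S (\<lambda>x. f x - g x)"
  using elementary_add[OF assms(1) elementary_mult[OF elementary_const[of _ "-1"] assms(2)]] by simp

lemma Ck_on_elementary:
  fixes f :: "'a::euclidean_space \<Rightarrow> 'b::euclidean_space"
  assumes "\<And>b. b \<in> Basis \<Longrightarrow> elementary_on S (\<lambda>x. f x \<bullet> b)" "open S"
  shows "Ck_on k f S"
  using assms(1)
proof (induction k arbitrary: f)
  have diff: "f differentiable (at x)"
    if "\<And>b. b \<in> Basis \<Longrightarrow> elementary_on S (\<lambda>x. f x \<bullet> b)" "x \<in> S" for f :: "'a \<Rightarrow> 'b" and x
    using elementary_onD(1)[OF that(1) assms(2) that(2)] differentiable_componentwise_within by blast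
  {
    case 0
    then show ?case
      using diff by (auto intro!: continuous_at_imp_continuous_on differentiable_imp_continuous_within)
  next
    case (Suc k)
    have "elementary_on S (\<lambda>x. frechet_derivative f (at x) v \<bullet> b)" if b: "b \<in> Basis" for v b
    proof (rule elementary_cong[OF elementary_onD(2)[OF Suc.prems[OF b] assms(2), of v]])
      fix x assume "x \<in> S"
      then have "(f has_derivative frechet_derivative f (at x)) (at x)"
        using diff[OF Suc.prems] frechet_derivative_works by blast
      note has_derivative_inner_left[OF this]
      from fun_cong[OF frechet_derivative_at[OF this], of v] show "frechet_derivative (\<lambda>x. f x \<bullet> b) (at x) v = frechet_derivative f (at x) v \<bullet> b"
        by simp
    qed
    then show ?case using Suc.IH diff[OF Suc.prems] by simp
  }
qed

text \<open>\<open>g\<close> need not agree with \<open>f\<close> off \<open>S\<close>. This serves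
  \<open>inv_into\<close>, whose agreement with an explicit formula is established only on the
  punctured hemisphere.\<close>

lemma smooth_on_elementary:
  fixes f :: "'a::euclidean_space \<Rightarrow> 'b::euclidean_space"
  assumes "\<And>b. b \<in> Basis \<Longrightarrow> elementary_on V (\<lambda>x. g x \<bullet> b)" "open V" "S \<subseteq> V"
    and "\<And>x. x \<in> S \<Longrightarrow> g x = f x"
  shows "smooth_on S f"
  unfolding smooth_on_def using assms Ck_on_elementary[OF assms(1,2)] by blast

section \<open>Time changes\<close>

lemma open_interval_connected: "open_interval J \<Longrightarrow> connected J"
  by (simp add: open_interval_def is_interval_connected_1)

text \<open>\<open>J\<close> may be unbounded and \<open>g\<close> need not be integrable up to its
  ends, so \<open>J\<close> is rewritten as an interval with extended real endpoints.\<close>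

lemma open_interval_antiderivative:
  fixes g :: "real \<Rightarrow> real"
  assumes "open_interval J" "continuous_on J g"
  shows "\<exists>F. \<forall>x\<in>J. (F has_real_derivative g x) (at x)"
proof -
  define a b where "a = Inf (ereal ` J)" and "b = Sup (ereal ` J)"
  have J: "open J" "is_interval J" "J \<noteq> {}" using assms(1) by (auto simp: open_interval_def)
  have 1: "a < ereal x \<and> ereal x < b" if x: "x \<in> J" for x
  proof -
    obtain e where e: "e > 0" "ball x e \<subseteq> J" using J(1) x by (metis open_contains_ball)
    then have "x - e/2 \<in> J" "x + e/2 \<in> J" by (auto simp: dist_real_def subset_iff)
    then have "a \<le> ereal (x - e/2)" "ereal (x + e/2) \<le> b"
      unfolding a_def b_def by (auto intro: INF_lower SUP_upper)
    moreover have "ereal (x - e/2) < ereal x" "ereal x < ereal (x + e/2)" using e by auto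
    ultimately show ?thesis by (meson le_less_trans less_le_trans)
  qed
  have 2: "x \<in> J" if x: "a < ereal x" "ereal x < b" for x
  proof -
    obtain y z where "y \<in> J" "y < x" "z \<in> J" "x < z"
      using x by (auto simp: a_def b_def INF_less_iff less_SUP_iff)
    then show ?thesis using mem_is_interval_1_I[OF J(2)] by (meson less_imp_le)
  qed
  have "a < b" using J(3) 1 by (meson ex_in_conv less_trans)
  moreover have "isCont g x" if "a < ereal x" "ereal x < b" for x
    using assms(2) J(1) 2[OF that] by (simp add: continuous_on_eq_continuous_at)
  ultimately obtain F where "\<forall>x. a < ereal x \<longrightarrow> ereal x < b \<longrightarrow> (F has_vector_derivative g x) (at x)"
    using einterval_antiderivative by metis
  then show ?thesis using 1 by (auto simp: has_real_derivative_iff_has_vector_derivative)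
qed

text \<open>Separation of variables for \<open>dt/d\<tau> = g(t)\<close>: \<open>\<tau>\<close> is
  an antiderivative \<open>F\<close> of \<open>1 / g\<close>, strictly increasing as
  \<open>g > 0\<close>, and \<open>t\<close> is its inverse.\<close>

lemma time_change_exists:
  fixes g :: "real \<Rightarrow> real"
  assumes J: "open_interval J" and g: "continuous_on J g" "\<And>x. x \<in> J \<Longrightarrow> g x > 0"
  shows "\<exists>t K. time_change t K J \<and> (\<forall>\<tau>\<in>K. (t has_real_derivative g (t \<tau>)) (at \<tau>))"
proof -
  have "continuous_on J (\<lambda>x. inverse (g x))"
    using g by (intro continuous_intros) (auto simp: less_imp_neq[symmetric] dest: g(2))
  then obtain F where F: "\<And>x. x \<in> J \<Longrightarrow> (F has_real_derivative inverse (g x)) (at x)"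
    using open_interval_antiderivative[OF J] by blast
  have J': "open J" "is_interval J" "J \<noteq> {}" using J by (auto simp: open_interval_def)
  have cont: "continuous_on J F"
    using F by (auto intro!: continuous_at_imp_continuous_on DERIV_isCont)
  have mono: "F x < F y" if "x \<in> J" "y \<in> J" "x < y" for x y
  proof (rule DERIV_pos_imp_increasing[OF \<open>x < y\<close>])
    fix z assume "x \<le> z" "z \<le> y"
    then have "z \<in> J" using mem_is_interval_1_I[OF J'(2) that(1,2)] by blast
    then show "\<exists>d. (F has_real_derivative d) (at z) \<and> 0 < d" using F g(2) by force
  qed
  then have inj: "inj_on F J" by (intro linorder_inj_onI) (auto, metis less_irrefl)
  define t where "t = inv_into J F"
  have op: "open (F ` J)" using invariance_of_domain[OF cont J'(1) inj] .
  have K: "open_interval (F ` J)"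
    using op J' cont by (auto simp: open_interval_def is_interval_connected_1 connected_continuous_image)
  have bij: "bij_betw t (F ` J) J" unfolding t_def using inj by (simp add: inj_on_imp_bij_betw bij_betw_inv_into)
  have tF: "t (F x) = x" if "x \<in> J" for x using inj that by (simp add: t_def)
  have "continuous_on (F ` J) t"
    by (rule continuous_on_inverse_open_map[OF cont refl])
       (use tF injective_into_1d_imp_open_map_UNIV[of _ J F] cont inj J' in \<open>auto simp: openin_open_eq op\<close>)
  then have iso: "isCont t y" if "y \<in> F ` J" for y
    using op that continuous_on_eq_continuous_at by blast
  have der: "(t has_real_derivative g (t y)) (at y)" if y: "y \<in> F ` J" for y
  proof -
    have ty: "t y \<in> J" using y tF by auto
    obtain e where e: "e > 0" "ball y e \<subseteq> F ` J" using op y by (metis open_contains_ball)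
    have "(t has_real_derivative inverse (inverse (g (t y)))) (at y)"
    proof (rule DERIV_inverse_function[where f = F and g = t, OF F[OF ty], where a = "y - e" and b = "y + e"])
      show "inverse (g (t y)) \<noteq> 0" using g(2)[OF ty] by simp
      show "isCont t y" using iso y by blast
      fix z assume "y - e < z" "z < y + e"
      then have "z \<in> F ` J" using e by (auto simp: dist_real_def subset_iff)
      then show "F (t z) = z" using tF by auto
    qed (use e in auto)
    then show ?thesis by simp
  qed
  have "g (t y) > 0" if "y \<in> F ` J" for y using that tF g(2) by auto
  then show ?thesis using K J bij der unfolding time_change_def by blast
qed


section \<open>Central projection of motions\<close>

lemma twice_differentiableI:
  fixes q :: "real \<Rightarrow> 'a::euclidean_space"
  assumes "open J" "t \<in> J" "\<And>s. s \<in> J \<Longrightarrow> (q has_vector_derivative q' s) (at s)"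
    and "(q' has_vector_derivative q'') (at t)"
  shows "q differentiable (at t) \<and> velocity q t = q' t \<and>
    velocity q differentiable (at t) \<and> velocity (velocity q) t = q''"
proof -
  have v: "velocity q s = q' s" if "s \<in> J" for s
    using assms(3)[OF that] by (simp add: velocity_def vector_derivative_at)
  have "(velocity q has_vector_derivative q'') (at t)"
    by (rule has_vector_derivative_transform_within_open[OF assms(4,1,2)]) (simp add: v)
  then show ?thesis
    using v[OF assms(2)] assms(2,3)
    by (auto simp: vector_derivative_at intro: differentiableI_vector) (simp add: velocity_def vector_derivative_at)
qed

lemma has_vector_derivative_velocity:
  "q differentiable (at t) \<Longrightarrow> (q has_vector_derivative velocity q t) (at t)"
  by (simp add: velocity_def vector_derivative_works)

lemma has_real_derivative_inner:
  fixes f g :: "real \<Rightarrow> 'a::real_inner"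
  assumes "(f has_vector_derivative f') (at t)" "(g has_vector_derivative g') (at t)"
  shows "((\<lambda>t. f t \<bullet> g t) has_real_derivative f t \<bullet> g' + f' \<bullet> g t) (at t)"
  using bounded_bilinear.has_vector_derivative[OF bounded_bilinear_inner assms]
  by (simp add: has_real_derivative_iff_has_vector_derivative)

lemma has_vector_derivative_compose_time:
  fixes f :: "real \<Rightarrow> 'a::real_normed_vector"
  assumes "(f has_vector_derivative f') (at (t \<tau>))" "(t has_real_derivative d) (at \<tau>)"
  shows "((\<lambda>\<tau>. f (t \<tau>)) has_vector_derivative d *\<^sub>R f') (at \<tau>)"
  using vector_diff_chain_at[OF assms(2)[unfolded has_real_derivative_iff_has_vector_derivative] assms(1)]
  by (simp add: o_def)

lemma time_changeD:
  assumes "time_change t K J"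
  shows "open K" "open J" "\<tau> \<in> K \<Longrightarrow> t \<tau> \<in> J"
  using assms by (auto simp: time_change_def open_interval_def bij_betw_def)

text \<open>With \<open>d\<tau> = dt / |y|\<^sup>2\<close> the second derivative of \<open>y / |y|\<close> contains no first derivative of \<open>y\<close>.\<close>

lemma radial_projection_motion:
  fixes y y1 y2 :: "real \<Rightarrow> 'a::euclidean_space"
  assumes tc: "time_change t K J"
    and y: "\<And>s. s \<in> J \<Longrightarrow> (y has_vector_derivative y1 s) (at s)"
    and y1: "\<And>s. s \<in> J \<Longrightarrow> (y1 has_vector_derivative y2 s) (at s)"
    and nz: "\<And>s. s \<in> J \<Longrightarrow> y s \<noteq> 0"
    and t: "\<And>\<tau>. \<tau> \<in> K \<Longrightarrow> (t has_real_derivative (norm (y (t \<tau>)))\<^sup>2) (at \<tau>)"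
    and \<tau>: "\<tau> \<in> K"
  defines "u \<equiv> \<lambda>\<tau>. (1 / norm (y (t \<tau>))) *\<^sub>R y (t \<tau>)"
  shows "u differentiable (at \<tau>) \<and> velocity u differentiable (at \<tau>) \<and>
    (\<exists>\<mu>. velocity (velocity u) \<tau> = (norm (y (t \<tau>)) ^ 3) *\<^sub>R y2 (t \<tau>) + \<mu> *\<^sub>R u \<tau>)"
proof -
  note KJ = time_changeD[OF tc]
  define r where "r s = norm (y s)" for s
  define r1 where "r1 s = (y s \<bullet> y1 s) / r s" for s
  have rpos: "r s > 0" if "s \<in> J" for s using nz[OF that] by (simp add: r_def)
  have r: "(r has_real_derivative r1 s) (at s)" if "s \<in> J" for s
  proof -
    have "((\<lambda>s. sqrt (y s \<bullet> y s)) has_real_derivative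
        inverse (sqrt (y s \<bullet> y s)) / 2 * (y s \<bullet> y1 s + y1 s \<bullet> y s)) (at s)"
      by (rule DERIV_chain2[OF DERIV_real_sqrt has_real_derivative_inner[OF y[OF that] y[OF that]]])
         (use nz[OF that] in simp)
    then show ?thesis
      by (simp add: r_def[abs_def] r1_def norm_eq_sqrt_inner inner_commute field_simps)
  qed
  \<comment> \<open>Existence of \<open>r2\<close> suffices: its value disappears in the unspecified
    multiple of \<open>u\<close>.\<close>
  have "\<exists>d. (r1 has_real_derivative d) (at s)" if "s \<in> J" for s
    unfolding r1_def[abs_def]
    using DERIV_divide[OF has_real_derivative_inner[OF y[OF that] y1[OF that]] r[OF that]
      less_imp_neq[OF rpos[OF that], symmetric]] by blast
  then obtain r2 where r2: "(r1 has_real_derivative r2 s) (at s)" if "s \<in> J" for s by metis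
  have d1: "(u has_vector_derivative r (t \<tau>) *\<^sub>R y1 (t \<tau>) - r1 (t \<tau>) *\<^sub>R y (t \<tau>)) (at \<tau>)"
    if "\<tau> \<in> K" for \<tau>
  proof -
    note s = KJ(3)[OF that]
    have "((\<lambda>s. 1 / r s) has_real_derivative - (r1 (t \<tau>) / (r (t \<tau>))\<^sup>2)) (at (t \<tau>))"
      using DERIV_divide[OF DERIV_const r[OF s], of 1] rpos[OF s] by (simp add: power2_eq_square)
    from has_vector_derivative_compose_time[OF has_vector_derivative_scaleR[OF this y[OF s]] t[OF that]]
    show ?thesis using rpos[OF s]
      by (simp add: u_def r_def[symmetric] scaleR_add_right scaleR_diff_right power2_eq_square)
  qed
  \<comment> \<open>The two terms \<open>r1 y1\<close> from the product rule cancel; this is the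
    effect of the rate \<open>r^2\<close>.\<close>
  have "((\<lambda>s. r s *\<^sub>R y1 s - r1 s *\<^sub>R y s) has_vector_derivative
      (r (t \<tau>) *\<^sub>R y2 (t \<tau>) - r2 (t \<tau>) *\<^sub>R y (t \<tau>))) (at (t \<tau>))"
    using has_vector_derivative_diff[OF
       has_vector_derivative_scaleR[OF r[OF KJ(3)[OF \<tau>]] y1[OF KJ(3)[OF \<tau>]]]
       has_vector_derivative_scaleR[OF r2[OF KJ(3)[OF \<tau>]] y[OF KJ(3)[OF \<tau>]]]]
    by (simp add: algebra_simps)
  from twice_differentiableI[OF KJ(1) \<tau> d1 has_vector_derivative_compose_time[OF this t[OF \<tau>]]]
  have *: "u differentiable (at \<tau>) \<and> velocity u differentiable (at \<tau>) \<and> velocity (velocity u) \<tau> =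
      (r (t \<tau>))\<^sup>2 *\<^sub>R (r (t \<tau>) *\<^sub>R y2 (t \<tau>) - r2 (t \<tau>) *\<^sub>R y (t \<tau>))"
    by (simp add: r_def)
  have "y (t \<tau>) = r (t \<tau>) *\<^sub>R u \<tau>" using rpos[OF KJ(3)[OF \<tau>]] by (simp add: u_def r_def)
  then have "(r (t \<tau>))\<^sup>2 *\<^sub>R (r (t \<tau>) *\<^sub>R y2 (t \<tau>) - r2 (t \<tau>) *\<^sub>R y (t \<tau>)) =
      (r (t \<tau>) ^ 3) *\<^sub>R y2 (t \<tau>) + (- (r (t \<tau>) ^ 3) * r2 (t \<tau>)) *\<^sub>R u \<tau>"
    by (simp add: scaleR_diff_right power2_eq_square power3_eq_cube mult_ac)
  with * show ?thesis unfolding r_def by metis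
qed

text \<open>The inverse of the previous projection, onto the plane \<open>n \<bullet> y = d\<close>.\<close>

lemma plane_projection_motion:
  fixes b :: "real \<Rightarrow> 'a::euclidean_space"
  assumes tc: "time_change s J K"
    and b: "\<And>\<tau>. \<tau> \<in> K \<Longrightarrow> b differentiable (at \<tau>) \<and> velocity b differentiable (at \<tau>)"
    and pos: "\<And>\<tau>. \<tau> \<in> K \<Longrightarrow> n \<bullet> b \<tau> > 0" and d: "d > 0"
    and s: "\<And>t. t \<in> J \<Longrightarrow> (s has_real_derivative ((n \<bullet> b (s t)) / d)\<^sup>2) (at t)"
    and t: "t \<in> J" and acc: "velocity (velocity b) (s t) = g *\<^sub>R e + \<mu> *\<^sub>R b (s t)"
  defines "y \<equiv> \<lambda>t. (d / (n \<bullet> b (s t))) *\<^sub>R b (s t)"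
  shows "y differentiable (at t) \<and> velocity y differentiable (at t) \<and> velocity (velocity y) t =
    (((n \<bullet> b (s t)) / d) ^ 3 * g) *\<^sub>R (e - ((n \<bullet> e) / d) *\<^sub>R y t)"
proof -
  note JK = time_changeD[OF tc]
  define b1 b2 where "b1 = velocity b" and "b2 = velocity (velocity b)"
  define w w1 w2 where "w \<tau> = n \<bullet> b \<tau>" and "w1 \<tau> = n \<bullet> b1 \<tau>" and "w2 \<tau> = n \<bullet> b2 \<tau>" for \<tau>
  have db: "(b has_vector_derivative b1 \<tau>) (at \<tau>)" "(b1 has_vector_derivative b2 \<tau>) (at \<tau>)"
    if "\<tau> \<in> K" for \<tau>
    using b[OF that] has_vector_derivative_velocity by (auto simp: b1_def b2_def)
  have dw: "(w has_real_derivative w1 \<tau>) (at \<tau>)" "(w1 has_real_derivative w2 \<tau>) (at \<tau>)"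
    if "\<tau> \<in> K" for \<tau>
    using has_real_derivative_inner[OF has_vector_derivative_const[of n] db(1)[OF that]]
      has_real_derivative_inner[OF has_vector_derivative_const[of n] db(2)[OF that]]
    by (simp_all add: w_def[abs_def] w1_def[abs_def] w2_def)
  have d1: "(y has_vector_derivative (1 / d) *\<^sub>R (w (s t) *\<^sub>R b1 (s t) - w1 (s t) *\<^sub>R b (s t))) (at t)"
    if "t \<in> J" for t
  proof -
    note k = JK(3)[OF that]
    have wp: "w (s t) > 0" using pos[OF k] by (simp add: w_def)
    have "((\<lambda>\<tau>. d / w \<tau>) has_real_derivative - (d * w1 (s t) / (w (s t))\<^sup>2)) (at (s t))"
      using DERIV_divide[OF DERIV_const dw(1)[OF k], of d] wp by (simp add: power2_eq_square)
    from has_vector_derivative_compose_time[OF has_vector_derivative_scaleR[OF this db(1)[OF k]] s[OF that]]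
    show ?thesis using wp d
      by (simp add: y_def w_def[symmetric] scaleR_add_right scaleR_diff_right power2_eq_square
          scaleR_left.minus field_simps)
  qed
  note k = JK(3)[OF t]
  have "((\<lambda>\<tau>. (1 / d) *\<^sub>R (w \<tau> *\<^sub>R b1 \<tau> - w1 \<tau> *\<^sub>R b \<tau>)) has_vector_derivative
      (1 / d) *\<^sub>R (w (s t) *\<^sub>R b2 (s t) - w2 (s t) *\<^sub>R b (s t))) (at (s t))"
    using bounded_linear.has_vector_derivative[OF bounded_linear_scaleR_right[of "1 / d"]
       has_vector_derivative_diff[OF has_vector_derivative_scaleR[OF dw(1)[OF k] db(2)[OF k]]
       has_vector_derivative_scaleR[OF dw(2)[OF k] db(1)[OF k]]]]
    by (simp add: algebra_simps)
  from twice_differentiableI[OF JK(1) t d1 has_vector_derivative_compose_time[OF this s[OF t]]]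
  have *: "y differentiable (at t) \<and> velocity y differentiable (at t) \<and> velocity (velocity y) t =
      ((w (s t)) / d)\<^sup>2 *\<^sub>R (1 / d) *\<^sub>R (w (s t) *\<^sub>R b2 (s t) - w2 (s t) *\<^sub>R b (s t))"
    by (simp add: w_def)
  \<comment> \<open>The contributions of \<open>\<mu>\<close> cancel, so the radial part of the
    spherical acceleration is invisible in the plane.\<close>
  have "w (s t) *\<^sub>R b2 (s t) - w2 (s t) *\<^sub>R b (s t) = g *\<^sub>R (w (s t) *\<^sub>R e - (n \<bullet> e) *\<^sub>R b (s t))"
    unfolding w2_def b2_def acc w_def by (simp add: algebra_simps inner_add_right)
  also have "w (s t) *\<^sub>R e - (n \<bullet> e) *\<^sub>R b (s t) = w (s t) *\<^sub>R (e - ((n \<bullet> e) / d) *\<^sub>R y t)"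
    using pos[OF k] d by (simp add: y_def w_def scaleR_diff_right)
  finally show ?thesis using *
    by (simp add: w_def power2_eq_square power3_eq_cube mult_ac)
qed

section \<open>The spherical equation of motion in ambient coordinates\<close>

lemma openin_open_hemisphere:
  "openin (top_of_set (sphere 0 1)) (open_hemisphere N - {A})"
proof -
  have "open ({u. N \<bullet> u > 0} - {A})"
    by (intro open_Diff open_Collect_less continuous_intros closed_singleton)
  moreover have "open_hemisphere N - {A} = sphere 0 1 \<inter> ({u. N \<bullet> u > 0} - {A})"
    by (auto simp: open_hemisphere_def)
  ultimately show ?thesis by (auto simp: openin_open)
qed

lemma unit_inner_less_1:
  fixes u A :: "'a::euclidean_space"
  assumes "norm u = 1" "norm A = 1" "u \<noteq> A" "u \<noteq> - A"
  shows "\<bar>u \<bullet> A\<bar> < 1"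
proof -
  have "\<bar>u \<bullet> A\<bar> \<le> 1" using Cauchy_Schwarz_ineq2[of u A] assms by simp
  moreover have "\<bar>u \<bullet> A\<bar> \<noteq> 1"
    using norm_cauchy_schwarz_abs_eq[of u A] assms by auto
  ultimately show ?thesis by simp
qed

text \<open>The derivative of \<open>cot (arccos s)\<close> is \<open>(1 - s^2) powr (-3/2)\<close>;
  it multiplies the part of \<open>A\<close> tangential at \<open>u\<close>.\<close>

lemma spherical_grad:
  assumes A: "A \<in> open_hemisphere N" and u: "u \<in> open_hemisphere N - {A}"
  shows "riemannian_grad (open_hemisphere N - {A}) (spherical_kepler_U m A) u =
    (m / sqrt (1 - (u \<bullet> A)\<^sup>2) ^ 3) *\<^sub>R (A - (u \<bullet> A) *\<^sub>R u)"
proof (rule riemannian_gradI)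
  have ts: "tangent_space (open_hemisphere N - {A}) u = {w. u \<bullet> w = 0}"
    by (rule tangent_space_sphere[OF openin_open_hemisphere u])
  \<comment> \<open>The antipode of \<open>A\<close> lies outside the hemisphere, so the sine of the
    angle vanishes only at the removed centre.\<close>
  have un: "norm u = 1" "norm A = 1" "u \<noteq> A" "u \<noteq> - A"
    using A u by (auto simp: open_hemisphere_def)
  have uu: "u \<bullet> u = 1" using un by (simp add: norm_eq_1)
  show "(m / sqrt (1 - (u \<bullet> A)\<^sup>2) ^ 3) *\<^sub>R (A - (u \<bullet> A) *\<^sub>R u) \<in> tangent_space (open_hemisphere N - {A}) u"
    by (simp add: ts inner_diff_right uu)
  show "subspace (tangent_space (open_hemisphere N - {A}) u)"
    unfolding ts by (rule subspace_hyperplane)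
  fix w \<gamma> assume c: "curve_through (open_hemisphere N - {A}) u w \<gamma>"
  have g: "\<gamma> 0 = u" "(\<gamma> has_vector_derivative w) (at 0)" using c by (auto simp: curve_through_def)
  have "w \<in> tangent_space (open_hemisphere N - {A}) u" using c by (auto simp: tangent_space_def)
  then have uw: "u \<bullet> w = 0" by (simp add: ts)
  define \<sigma> where "\<sigma> = u \<bullet> A"
  have lt: "\<bar>\<sigma>\<bar> < 1" unfolding \<sigma>_def by (rule unit_inner_less_1[OF un])
  have sin: "sin (arccos \<sigma>) = sqrt (1 - \<sigma>\<^sup>2)" using lt by (intro sin_arccos) linarith+
  have pos: "1 - \<sigma>\<^sup>2 > 0" using lt by (simp add: abs_square_less_1)
  have "((\<lambda>s. \<gamma> s \<bullet> A) has_real_derivative w \<bullet> A) (at 0)"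
    using has_real_derivative_inner[OF g(2) has_vector_derivative_const[of A]] by simp
  then have arc: "((\<lambda>s. arccos (\<gamma> s \<bullet> A)) has_real_derivative inverse (- sqrt (1 - \<sigma>\<^sup>2)) * (w \<bullet> A)) (at 0)"
    using lt g(1) DERIV_chain2[of arccos _ "\<lambda>s. \<gamma> s \<bullet> A" 0, OF DERIV_arccos] by (simp add: \<sigma>_def)
  have "((\<lambda>s. cot (arccos (\<gamma> s \<bullet> A))) has_real_derivative
      - inverse ((sin (arccos \<sigma>))\<^sup>2) * (inverse (- sqrt (1 - \<sigma>\<^sup>2)) * (w \<bullet> A))) (at 0)"
    using pos sin g(1) DERIV_chain2[OF _ arc, of cot, OF DERIV_cot] by (simp add: \<sigma>_def)
  from DERIV_cmult[OF this, of m]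
  have "((\<lambda>s. spherical_kepler_U m A (\<gamma> s)) has_real_derivative
      m / sqrt (1 - \<sigma>\<^sup>2) ^ 3 * (w \<bullet> A)) (at 0)"
    using pos by (simp add: spherical_kepler_U_def sin field_simps power3_eq_cube)
  moreover have "((m / sqrt (1 - (u \<bullet> A)\<^sup>2) ^ 3) *\<^sub>R (A - (u \<bullet> A) *\<^sub>R u)) \<bullet> w =
      m / sqrt (1 - \<sigma>\<^sup>2) ^ 3 * (w \<bullet> A)"
    by (simp add: inner_diff_left uw \<sigma>_def inner_commute[of w A])
  ultimately show "((\<lambda>s. spherical_kepler_U m A (\<gamma> s)) has_real_derivative
      ((m / sqrt (1 - (u \<bullet> A)\<^sup>2) ^ 3) *\<^sub>R (A - (u \<bullet> A) *\<^sub>R u)) \<bullet> w) (at 0)" by simp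
qed

lemma obeys_motion_spherical_kepler:
  assumes "A \<in> open_hemisphere N"
  shows "obeys_motion (open_hemisphere N - {A}) (spherical_kepler_U m A) q t \<longleftrightarrow>
    q t \<in> open_hemisphere N - {A} \<and> q differentiable (at t) \<and> velocity q differentiable (at t) \<and>
    velocity (velocity q) t - (velocity (velocity q) t \<bullet> q t) *\<^sub>R q t =
      (m / sqrt (1 - (q t \<bullet> A)\<^sup>2) ^ 3) *\<^sub>R (A - (q t \<bullet> A) *\<^sub>R q t)"
proof -
  have "tangential_part (open_hemisphere N - {A}) u w = w - (w \<bullet> u) *\<^sub>R u"
    if u: "u \<in> open_hemisphere N - {A}" for u w
  proof -
    have uu: "u \<bullet> u = 1" using u by (simp add: open_hemisphere_def norm_eq_1)
    show ?thesis
      by (rule tangential_partI)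
         (auto simp: tangent_space_sphere[OF openin_open_hemisphere u] inner_diff_right uu
           subspace_hyperplane2 subspace_hyperplane inner_commute)
  qed
  then show ?thesis
    unfolding obeys_motion_def covariant_acceleration_def
    by (simp only: spherical_grad[OF assms] cong: conj_cong)
qed


section \<open>The projection of the tilted plane\<close>

definition pole :: "real^3" where "pole = axis 3 1"

definition horizontal :: "real^2 \<Rightarrow> real^3" where "horizontal x = vector [x $ 1, x $ 2, 0]"

definition plane_part :: "real^3 \<Rightarrow> real^2" where "plane_part u = vector [u $ 1, u $ 2]"

lemma inner_2: "x \<bullet> y = x $ 1 * y $ 1 + x $ 2 * y $ 2" for x y :: "real^2"
  by (simp add: inner_vec_def sum_2)

lemma inner_3: "x \<bullet> y = x $ 1 * y $ 1 + x $ 2 * y $ 2 + x $ 3 * y $ 3" for x y :: "real^3"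
  by (simp add: inner_vec_def sum_3)

lemma pole_nth [simp]: "pole $ 1 = 0" "pole $ 2 = 0" "pole $ 3 = 1"
  by (simp_all add: pole_def axis_def)

lemma horizontal_nth [simp]: "horizontal x $ 1 = x $ 1" "horizontal x $ 2 = x $ 2" "horizontal x $ 3 = 0"
  by (simp_all add: horizontal_def)

lemma plane_part_nth [simp]: "plane_part u $ 1 = u $ 1" "plane_part u $ 2 = u $ 2"
  by (simp_all add: plane_part_def)

lemma inner_horizontal [simp]: "horizontal x \<bullet> horizontal y = x \<bullet> y"
  and inner_horizontal_pole [simp]: "horizontal x \<bullet> pole = 0" "pole \<bullet> horizontal x = 0"
  and inner_pole_pole [simp]: "pole \<bullet> pole = 1" and norm_pole [simp]: "norm pole = 1"
  by (simp_all add: inner_2 inner_3 norm_eq_sqrt_inner)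

lemma plane_part_pole [simp]: "plane_part pole = 0"
  and plane_part_horizontal [simp]: "plane_part (horizontal x) = x"
  by (simp_all add: vec_eq_iff forall_2)

lemma horizontal_plane_part: "horizontal (plane_part u) = u - (u \<bullet> pole) *\<^sub>R pole"
  by (simp add: vec_eq_iff forall_3 inner_3)

lemma inner_plane_part: "x \<bullet> plane_part u = horizontal x \<bullet> u"
  by (simp add: inner_2 inner_3)

lemma linear_horizontal: "linear horizontal" and linear_plane_part: "linear plane_part"
  by (auto intro!: linearI simp: vec_eq_iff forall_2 forall_3)

lemmas bounded_linear_horizontal = linear_horizontal[unfolded linear_conv_bounded_linear]
lemmas bounded_linear_plane_part = linear_plane_part[unfolded linear_conv_bounded_linear]

text \<open>The linear part of \<open>lift\<close>, acting on velocities and accelerations.\<close>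

definition tilt :: "real^2 \<Rightarrow> real^2 \<Rightarrow> real^3" where
  "tilt h v = horizontal v - (h \<bullet> v) *\<^sub>R pole"

definition lift :: "real^2 \<Rightarrow> real^2 \<Rightarrow> real^3" where
  "lift h x = tilt h x + (1 + h \<bullet> h) *\<^sub>R pole"

definition normal :: "real^2 \<Rightarrow> real^3" where "normal h = horizontal h + pole"

definition project :: "real^2 \<Rightarrow> real^2 \<Rightarrow> real^2 \<Rightarrow> real^3" where
  "project h Z q = (1 / norm (lift h (q - Z))) *\<^sub>R lift h (q - Z)"

text \<open>The factor rescales \<open>u\<close> into the lifted plane, on which
  \<open>normal h\<close> has the constant inner product \<open>1 + h \<bullet> h\<close>; then the
  height is dropped.\<close>

definition unproject :: "real^2 \<Rightarrow> real^2 \<Rightarrow> real^3 \<Rightarrow> real^2" where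
  "unproject h Z u = Z + ((1 + h \<bullet> h) / (normal h \<bullet> u)) *\<^sub>R plane_part u"

text \<open>Axis of the hemisphere covered by the projection. For \<open>h \<noteq> 0\<close> it
  differs from \<open>pole\<close>, the centre of the spherical system.\<close>

definition zenith :: "real^2 \<Rightarrow> real^3" where "zenith h = (1 / norm (normal h)) *\<^sub>R normal h"

lemma one_plus_inner_self_pos: "1 + h \<bullet> h > 0" for h :: "'a::real_inner"
  by (simp add: add_pos_nonneg)

lemma bounded_linear_tilt: "bounded_linear (tilt h)"
  unfolding tilt_def[abs_def]
  by (intro bounded_linear_sub bounded_linear_horizontal bounded_linear_scaleR_const
      bounded_linear_inner_right)

lemma plane_part_tilt [simp]: "plane_part (tilt h v) = v"
  and plane_part_lift [simp]: "plane_part (lift h x) = x"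
  by (simp_all add: lift_def tilt_def vec_eq_iff forall_2)

lemma normal_inner_tilt: "normal h \<bullet> tilt h v = 0"
  by (simp add: normal_def tilt_def inner_add_left inner_diff_right)

lemma normal_inner_pole [simp]: "normal h \<bullet> pole = 1"
  by (simp add: normal_def inner_add_left)

lemma normal_inner_lift: "normal h \<bullet> lift h x = 1 + h \<bullet> h"
  by (simp add: lift_def inner_add_right normal_inner_tilt)

lemma lift_nonzero: "lift h x \<noteq> 0"
  using normal_inner_lift[of h x] one_plus_inner_self_pos[of h] by auto

lemma lift_inner_pole: "lift h x \<bullet> pole = 1 + h \<bullet> h - h \<bullet> x"
  by (simp add: lift_def tilt_def inner_add_left inner_diff_left)

lemma norm_lift: "(norm (lift h x))\<^sup>2 = x \<bullet> x + (1 + h \<bullet> h - h \<bullet> x)\<^sup>2"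
  unfolding power2_norm_eq_inner
  by (simp add: lift_def tilt_def inner_add_left inner_add_right inner_diff_left inner_diff_right
      power2_eq_square algebra_simps)

lemma norm_normal_pos: "norm (normal h) > 0"
  using normal_inner_pole[of h] by (auto simp del: normal_inner_pole)

lemma norm_zenith: "norm (zenith h) = 1"
  using norm_normal_pos[of h] by (simp add: zenith_def)

lemma open_hemisphere_zenith: "open_hemisphere (zenith h) = {u. norm u = 1 \<and> normal h \<bullet> u > 0}"
  using norm_normal_pos[of h] by (auto simp: open_hemisphere_def zenith_def zero_less_divide_iff)

lemma pole_in_hemisphere: "pole \<in> open_hemisphere (zenith h)"
  by (simp add: open_hemisphere_zenith)

lemma project_in_hemisphere: "project h Z q \<in> open_hemisphere (zenith h)"
  using lift_nonzero[of h "q - Z"] one_plus_inner_self_pos[of h]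
  by (simp add: open_hemisphere_zenith project_def normal_inner_lift)

lemma unproject_project: "unproject h Z (project h Z q) = q"
proof -
  have "norm (lift h (q - Z)) > 0" using lift_nonzero by simp
  then show ?thesis
    using one_plus_inner_self_pos[of h]
    by (simp add: unproject_def project_def normal_inner_lift linear_scale[OF linear_plane_part])
qed

lemma lift_unproject:
  assumes "normal h \<bullet> u \<noteq> 0"
  shows "lift h (unproject h Z u - Z) = ((1 + h \<bullet> h) / (normal h \<bullet> u)) *\<^sub>R u"
proof -
  define c where "c = (1 + h \<bullet> h) / (normal h \<bullet> u)"
  have c: "1 + h \<bullet> h = c * (horizontal h \<bullet> u + pole \<bullet> u)"
    using assms by (simp add: c_def normal_def inner_add_left)
  have "lift h (c *\<^sub>R plane_part u) = c *\<^sub>R u"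
    unfolding lift_def tilt_def c
    by (simp add: linear_scale[OF linear_horizontal] horizontal_plane_part inner_plane_part algebra_simps inner_commute)
  then show ?thesis by (simp add: unproject_def c_def)
qed

lemma project_unproject:
  assumes "u \<in> open_hemisphere (zenith h)"
  shows "project h Z (unproject h Z u) = u"
proof -
  have u: "norm u = 1" "normal h \<bullet> u > 0" using assms by (auto simp: open_hemisphere_zenith)
  then show ?thesis
    using one_plus_inner_self_pos[of h] by (simp add: project_def lift_unproject)
qed

lemma project_center: "project h Z Z = pole"
  using one_plus_inner_self_pos[of h]
  by (simp add: project_def lift_def linear_0[OF bounded_linear.linear[OF bounded_linear_tilt]])

lemma unproject_center: "unproject h Z pole = Z"
  by (simp add: unproject_def)

lemma bij_betw_project: "bij_betw (project h Z) (- {Z}) (open_hemisphere (zenith h) - {pole})"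
proof (rule bij_betw_byWitness[where f' = "unproject h Z"])
  show "project h Z ` (- {Z}) \<subseteq> open_hemisphere (zenith h) - {pole}"
  proof (rule image_subsetI)
    fix q assume "q \<in> - {Z}"
    then have "project h Z q \<noteq> pole"
      using unproject_project[of h Z q] unproject_center[of h Z] by auto
    then show "project h Z q \<in> open_hemisphere (zenith h) - {pole}"
      using project_in_hemisphere by blast
  qed
  show "unproject h Z ` (open_hemisphere (zenith h) - {pole}) \<subseteq> - {Z}"
  proof (rule image_subsetI)
    fix u assume "u \<in> open_hemisphere (zenith h) - {pole}"
    then show "unproject h Z u \<in> - {Z}"
      using project_unproject[of u h Z] project_center[of h Z] by auto
  qed
qed (auto simp: unproject_project project_unproject)

lemma inv_into_project:
  assumes "u \<in> open_hemisphere (zenith h) - {pole}"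
  shows "inv_into (- {Z}) (project h Z) u = unproject h Z u"
  using assms bij_betw_project[of h Z]
  by (metis bij_betw_imp_surj_on inv_into_into f_inv_into_f unproject_project)

text \<open>\<open>A\<close> is the identity for maps of the plane and \<open>fst\<close> for
  functions on phase space.\<close>

lemma elementary_lift_nth:
  assumes "bounded_linear A"
  shows "elementary_on S (\<lambda>p. lift h (A p - Z) $ i)"
proof -
  have *: "lift h (A p - Z) $ i = tilt h (A p) $ i + lift h (- Z) $ i" for p
    using linear_diff[OF bounded_linear.linear[OF bounded_linear_tilt], of h "A p" Z]
      linear_neg[OF bounded_linear.linear[OF bounded_linear_tilt], of h Z]
    by (simp add: lift_def)
  show ?thesis unfolding *
    by (intro elementary_add elementary_const elementary_linear bounded_linear_compose[OF bounded_linear_vec_nth]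
        bounded_linear_compose[OF bounded_linear_tilt] assms)
qed

lemma elementary_norm_lift_sq:
  assumes "bounded_linear A"
  shows "elementary_on S (\<lambda>p. (norm (lift h (A p - Z)))\<^sup>2)"
  unfolding power2_norm_eq_inner inner_3
  by (intro elementary_add elementary_mult elementary_lift_nth assms)

lemma elementary_project:
  assumes "b \<in> Basis"
  shows "elementary_on UNIV (\<lambda>q. project h Z q \<bullet> b)"
proof -
  obtain i where b: "b = axis i 1" using assms by (auto simp: Basis_vec_def)
  \<comment> \<open>The norm appears as the root of its square, a polynomial, to match the rules of
    \<open>elementary_on\<close>.\<close>
  have eq: "project h Z q \<bullet> b = inverse (sqrt ((norm (lift h (q - Z)))\<^sup>2)) * lift h (q - Z) $ i" for q
    by (simp add: project_def b inner_axis divide_inverse)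
  show ?thesis unfolding eq
    using lift_nonzero
    by (intro elementary_mult elementary_inverse elementary_sqrt
        elementary_norm_lift_sq[OF bounded_linear_ident] elementary_lift_nth[OF bounded_linear_ident]) auto
qed

lemma diffeomorphism_project:
  "diffeomorphism (project h Z) (- {Z}) (open_hemisphere (zenith h) - {pole})"
  unfolding diffeomorphism_def
proof (intro conjI)
  show "bij_betw (project h Z) (- {Z}) (open_hemisphere (zenith h) - {pole})"
    by (rule bij_betw_project)
  show "smooth_on (- {Z}) (project h Z)"
    by (rule smooth_on_elementary[OF elementary_project open_UNIV]) auto
  let ?V = "{u. normal h \<bullet> u > 0}"
  have "elementary_on ?V (\<lambda>u. unproject h Z u \<bullet> b)" if "b \<in> Basis" for b
  proof -
    have eq: "unproject h Z u \<bullet> b =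
        Z \<bullet> b + (1 + h \<bullet> h) * inverse (normal h \<bullet> u) * (plane_part u \<bullet> b)" for u
      by (simp add: unproject_def inner_add_left divide_inverse)
    show ?thesis unfolding eq
      by (intro elementary_add elementary_mult elementary_inverse elementary_const elementary_linear
          bounded_linear_inner_right bounded_linear_compose[OF bounded_linear_inner_left bounded_linear_plane_part]) auto
  qed
  then show "smooth_on (open_hemisphere (zenith h) - {pole}) (inv_into (- {Z}) (project h Z))"
    by (rule smooth_on_elementary[where V = ?V])
       (auto simp: inv_into_project open_hemisphere_zenith intro!: open_Collect_less continuous_intros)
qed

section \<open>Orbits correspond in both directions\<close>

lemma orbit_planar_kepler:
  "orbit (- {Z}) (planar_kepler_U m Z) a J \<longleftrightarrow> open_interval J \<and> (\<forall>t\<in>J. a t \<noteq> Z \<and>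
    a differentiable (at t) \<and> velocity a differentiable (at t) \<and>
    velocity (velocity a) t = - (m / norm (a t - Z) ^ 3) *\<^sub>R (a t - Z))"
  unfolding orbit_def using obeys_motion_planar_kepler[OF open_Compl[OF closed_singleton], of Z Z m a] by simp

text \<open>Both sides are the sine of the angle to the pole, whose cube divides the spherical
  force.\<close>

lemma norm_plane_part_unit:
  assumes "norm u = 1"
  shows "sqrt (1 - (u \<bullet> pole)\<^sup>2) = norm (plane_part u)"
proof -
  have "plane_part u \<bullet> plane_part u = 1 - (u \<bullet> pole)\<^sup>2"
    using assms by (simp add: norm_eq_1 inner_2 inner_3 power2_eq_square)
  then show ?thesis by (simp add: norm_eq_sqrt_inner)
qed

text \<open>Since \<open>tilt h x = lift h x - (1 + h \<bullet> h) *\<^sub>R pole\<close>, the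
  lifted acceleration is a combination of \<open>u\<close> and \<open>pole\<close>, and tangential
  projection removes the multiple of \<open>u\<close>.\<close>

lemma spherical_orbit_of_planar:
  assumes a: "orbit (- {Z}) (planar_kepler_U m Z) a J" and tc: "time_change t K J"
    and t: "\<And>\<tau>. \<tau> \<in> K \<Longrightarrow> (t has_real_derivative (norm (lift h (a (t \<tau>) - Z)))\<^sup>2) (at \<tau>)"
  shows "orbit (open_hemisphere (zenith h) - {pole}) (spherical_kepler_U (m * (1 + h \<bullet> h)) pole)
    (project h Z \<circ> a \<circ> t) K"
  unfolding orbit_def
proof (intro conjI ballI)
  show "open_interval K" using tc by (simp add: time_change_def)
  fix \<tau> assume \<tau>: "\<tau> \<in> K"
  define y where "y s = lift h (a s - Z)" for s
  note tJ = time_changeD(3)[OF tc \<tau>]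
  have aJ: "a s \<noteq> Z" "a differentiable (at s)" "velocity a differentiable (at s)"
    "velocity (velocity a) s = - (m / norm (a s - Z) ^ 3) *\<^sub>R (a s - Z)" if "s \<in> J" for s
    using a that by (auto simp: orbit_planar_kepler)
  have y1: "(y has_vector_derivative tilt h (velocity a s)) (at s)" if "s \<in> J" for s
    unfolding y_def[abs_def] lift_def
    using bounded_linear.has_vector_derivative[OF bounded_linear_tilt
        has_vector_derivative_diff[OF has_vector_derivative_velocity[OF aJ(2)[OF that]] has_vector_derivative_const], of h Z]
    by (auto intro!: derivative_eq_intros)
  have y2: "((\<lambda>s. tilt h (velocity a s)) has_vector_derivative tilt h (velocity (velocity a) s)) (at s)"
    if "s \<in> J" for s
    by (rule bounded_linear.has_vector_derivative[OF bounded_linear_tilt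
        has_vector_derivative_velocity[OF aJ(3)[OF that]]])
  define u where "u = project h Z \<circ> a \<circ> t"
  have u: "u = (\<lambda>\<tau>. (1 / norm (y (t \<tau>))) *\<^sub>R y (t \<tau>))"
    by (simp add: u_def project_def y_def fun_eq_iff)
  define r x where "r = norm (y (t \<tau>))" and "x = a (t \<tau>) - Z"
  have rpos: "r > 0" using lift_nonzero by (simp add: r_def y_def)
  have xpos: "norm x > 0" using aJ(1)[OF tJ] by (simp add: x_def)
  obtain \<mu> where \<mu>: "u differentiable (at \<tau>)" "velocity u differentiable (at \<tau>)"
    "velocity (velocity u) \<tau> = (r ^ 3) *\<^sub>R tilt h (velocity (velocity a) (t \<tau>)) + \<mu> *\<^sub>R u \<tau>"
    using radial_projection_motion[OF tc y1 y2 _ _ \<tau>] lift_nonzero t unfolding u r_def by (auto simp: y_def)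
  have uH: "u \<tau> \<in> open_hemisphere (zenith h) - {pole}"
    using aJ(1)[OF tJ] bij_betw_project[of h Z] by (auto simp: u_def bij_betw_def)
  then have un: "norm (u \<tau>) = 1" by (auto simp: open_hemisphere_zenith)
  have yu: "lift h x = r *\<^sub>R u \<tau>" using rpos by (simp add: u y_def[symmetric] x_def r_def)
  have "tilt h (velocity (velocity a) (t \<tau>)) = - (m / norm x ^ 3) *\<^sub>R tilt h x"
    unfolding aJ(4)[OF tJ] x_def by (rule linear_scale[OF bounded_linear.linear[OF bounded_linear_tilt]])
  also have "tilt h x = r *\<^sub>R u \<tau> - (1 + h \<bullet> h) *\<^sub>R pole" using yu by (simp add: lift_def algebra_simps)
  finally have tl: "tilt h (velocity (velocity a) (t \<tau>)) =
      - (m / norm x ^ 3) *\<^sub>R (r *\<^sub>R u \<tau> - (1 + h \<bullet> h) *\<^sub>R pole)" .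
  have acc: "velocity (velocity u) \<tau> = (r ^ 3 * m / norm x ^ 3 * (1 + h \<bullet> h)) *\<^sub>R pole
      + (\<mu> - r ^ 4 * m / norm x ^ 3) *\<^sub>R u \<tau>"
    unfolding \<mu>(3) tl by (simp add: algebra_simps power4_eq_xxxx power3_eq_cube add_divide_distrib)
  have "plane_part (u \<tau>) = (1 / r) *\<^sub>R x"
    using arg_cong[OF yu, of plane_part] rpos by (simp add: linear_scale[OF linear_plane_part])
  \<comment> \<open>This turns the factor \<open>r^3 / |x|^3\<close> of the force into the inverse
    cube of the sine.\<close>
  then have s: "sqrt (1 - (u \<tau> \<bullet> pole)\<^sup>2) = norm x / r"
    using norm_plane_part_unit[OF un] rpos by simp
  have uu: "u \<tau> \<bullet> u \<tau> = 1" using un by (simp add: norm_eq_1)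
  have "velocity (velocity u) \<tau> - (velocity (velocity u) \<tau> \<bullet> u \<tau>) *\<^sub>R u \<tau> =
      (r ^ 3 * m / norm x ^ 3 * (1 + h \<bullet> h)) *\<^sub>R (pole - (u \<tau> \<bullet> pole) *\<^sub>R u \<tau>)"
    unfolding acc by (simp add: inner_add_left uu inner_commute algebra_simps)
  also have "r ^ 3 * m / norm x ^ 3 * (1 + h \<bullet> h) = (m * (1 + h \<bullet> h)) / sqrt (1 - (u \<tau> \<bullet> pole)\<^sup>2) ^ 3"
    unfolding s using xpos rpos by (simp add: field_simps)
  finally show "obeys_motion (open_hemisphere (zenith h) - {pole}) (spherical_kepler_U (m * (1 + h \<bullet> h)) pole)
      (project h Z \<circ> a \<circ> t) \<tau>"
    unfolding u_def[symmetric] obeys_motion_spherical_kepler[OF pole_in_hemisphere]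
    using uH \<mu>(1,2) by blast
qed

text \<open>The rate is \<open>1 / |y|^2\<close> at the point \<open>y\<close> of the lifted plane
  over the unit vector \<open>b\<close>, the reciprocal of the forward rate.\<close>

lemma planar_orbit_of_spherical:
  assumes b: "orbit (open_hemisphere (zenith h) - {pole}) (spherical_kepler_U (m * (1 + h \<bullet> h)) pole) b K"
    and tc: "time_change s J K"
    and s: "\<And>t. t \<in> J \<Longrightarrow> (s has_real_derivative ((normal h \<bullet> b (s t)) / (1 + h \<bullet> h))\<^sup>2) (at t)"
  shows "orbit (- {Z}) (planar_kepler_U m Z) (inv_into (- {Z}) (project h Z) \<circ> b \<circ> s) J"
  unfolding orbit_planar_kepler
proof (intro conjI ballI)
  show "open_interval J" using tc by (simp add: time_change_def)
  note JK = time_changeD[OF tc]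
  define d where "d = 1 + h \<bullet> h"
  have d: "d > 0" using one_plus_inner_self_pos by (simp add: d_def)
  define a where "a = inv_into (- {Z}) (project h Z) \<circ> b \<circ> s"
  have b': "b \<tau> \<in> open_hemisphere (zenith h) - {pole}" "b differentiable (at \<tau>)"
    "velocity b differentiable (at \<tau>)"
    "velocity (velocity b) \<tau> - (velocity (velocity b) \<tau> \<bullet> b \<tau>) *\<^sub>R b \<tau> =
      (m * d / sqrt (1 - (b \<tau> \<bullet> pole)\<^sup>2) ^ 3) *\<^sub>R (pole - (b \<tau> \<bullet> pole) *\<^sub>R b \<tau>)"
    if "\<tau> \<in> K" for \<tau>
    using b that
    by (auto simp: orbit_def d_def obeys_motion_spherical_kepler[OF pole_in_hemisphere])
  have bn: "norm (b \<tau>) = 1" "normal h \<bullet> b \<tau> > 0" if "\<tau> \<in> K" for \<tau>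
    using b'(1)[OF that] by (auto simp: open_hemisphere_zenith)
  define y where "y t = (d / (normal h \<bullet> b (s t))) *\<^sub>R b (s t)" for t
  have ay: "a t = Z + plane_part (y t)" if "t \<in> J" for t
    using inv_into_project[OF b'(1)[OF JK(3)[OF that]]]
    by (simp add: a_def unproject_def y_def d_def linear_scale[OF linear_plane_part])
  define g where "g \<tau> = m * d / sqrt (1 - (b \<tau> \<bullet> pole)\<^sup>2) ^ 3" for \<tau>
  have y: "y differentiable (at t)" "velocity y differentiable (at t)"
    "velocity (velocity y) t = (((normal h \<bullet> b (s t)) / d) ^ 3 * g (s t)) *\<^sub>R (pole - (1 / d) *\<^sub>R y t)"
    if t: "t \<in> J" for t
  proof -
    define \<mu> where "\<mu> = velocity (velocity b) (s t) \<bullet> b (s t) - g (s t) * (b (s t) \<bullet> pole)"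
    have "velocity (velocity b) (s t) = g (s t) *\<^sub>R pole + \<mu> *\<^sub>R b (s t)"
      using b'(4)[OF JK(3)[OF t], folded g_def] by (simp add: \<mu>_def algebra_simps)
    from plane_projection_motion[OF tc _ _ d _ t this, of "normal h"]
    show "y differentiable (at t)" "velocity y differentiable (at t)"
      "velocity (velocity y) t = (((normal h \<bullet> b (s t)) / d) ^ 3 * g (s t)) *\<^sub>R (pole - (1 / d) *\<^sub>R y t)"
      using b'(2,3) bn(2) s unfolding y_def[abs_def] d_def by auto
  qed
  fix t assume t: "t \<in> J"
  note k = JK(3)[OF t]
  have a1: "(a has_vector_derivative plane_part (velocity y t)) (at t)" if "t \<in> J" for t
  proof (rule has_vector_derivative_transform_within_open[OF _ JK(1) that])
    show "((\<lambda>t. Z + plane_part (y t)) has_vector_derivative plane_part (velocity y t)) (at t)"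
      using has_vector_derivative_add[OF has_vector_derivative_const
          bounded_linear.has_vector_derivative[OF bounded_linear_plane_part
            has_vector_derivative_velocity[OF y(1)[OF that]]]] by simp
  qed (use ay in simp)
  have a2: "((\<lambda>t. plane_part (velocity y t)) has_vector_derivative plane_part (velocity (velocity y) t)) (at t)"
    by (rule bounded_linear.has_vector_derivative[OF bounded_linear_plane_part
            has_vector_derivative_velocity[OF y(2)[OF t]]])
  note acc = twice_differentiableI[OF JK(1) t a1 a2]
  define x w where "x = a t - Z" and "w = normal h \<bullet> b (s t)"
  have w: "w > 0" using bn(2)[OF k] by (simp add: w_def)
  have "unproject h Z (b (s t)) \<in> - {Z}"
    using inv_into_into[of "b (s t)" "project h Z" "- {Z}"] inv_into_project[OF b'(1)[OF k]]
      b'(1)[OF k] bij_betw_project[of h Z] by (simp add: bij_betw_def)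
  then have anz: "a t \<noteq> Z" using inv_into_project[OF b'(1)[OF k], of Z] by (simp add: a_def)
  then have xpos: "norm x > 0" by (simp add: x_def)
  have xy: "plane_part (y t) = x" using ay[OF t] by (simp add: x_def)
  have "x = (d / w) *\<^sub>R plane_part (b (s t))"
    using xy by (simp add: y_def w_def linear_scale[OF linear_plane_part])
  then have "norm (plane_part (b (s t))) = w / d * norm x" using w d by simp
  then have sq: "sqrt (1 - (b (s t) \<bullet> pole)\<^sup>2) = w / d * norm x"
    using norm_plane_part_unit[OF bn(1)[OF k]] by simp
  \<comment> \<open>\<open>plane_part\<close> kills \<open>pole\<close> and maps \<open>y t\<close>
    to \<open>x\<close>, which leaves a central force.\<close>
  have "plane_part (velocity (velocity y) t) = - ((w / d) ^ 3 * g (s t) / d) *\<^sub>R x"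
    unfolding y(3)[OF t]
    by (simp add: linear_scale[OF linear_plane_part] linear_diff[OF linear_plane_part] xy w_def)
  also have "(w / d) ^ 3 * g (s t) / d = m / norm x ^ 3"
    unfolding g_def sq using w d xpos by (simp add: field_simps)
  finally show "velocity (velocity (inv_into (- {Z}) (project h Z) \<circ> b \<circ> s)) t =
      - (m / norm ((inv_into (- {Z}) (project h Z) \<circ> b \<circ> s) t - Z) ^ 3) *\<^sub>R
      ((inv_into (- {Z}) (project h Z) \<circ> b \<circ> s) t - Z)"
    using acc unfolding a_def[symmetric] x_def by simp
  show "(inv_into (- {Z}) (project h Z) \<circ> b \<circ> s) t \<noteq> Z" 
    "inv_into (- {Z}) (project h Z) \<circ> b \<circ> s differentiable (at t)"
    "velocity (inv_into (- {Z}) (project h Z) \<circ> b \<circ> s) differentiable (at t)"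
    using anz acc unfolding a_def[symmetric] by simp_all
qed

definition time_rate :: "real^2 \<Rightarrow> real^2 \<Rightarrow> (real^2) \<times> (real^2) \<Rightarrow> real" where
  "time_rate h Z p = (norm (lift h (fst p - Z)))\<^sup>2"

lemma correspondence_project:
  "correspondence (- {Z}) (planar_kepler_U m Z)
     (open_hemisphere (zenith h) - {pole}) (spherical_kepler_U (m * (1 + h \<bullet> h)) pole)
     (project h Z) (time_rate h Z)"
  unfolding correspondence_def
proof (intro conjI allI impI ballI)
  show "diffeomorphism (project h Z) (- {Z}) (open_hemisphere (zenith h) - {pole})"
    by (rule diffeomorphism_project)
  show "smooth_on (tangent_bundle (- {Z})) (time_rate h Z)"
    by (rule smooth_on_elementary[where V = UNIV])
       (auto simp: time_rate_def Basis_real_def intro: elementary_norm_lift_sq[OF bounded_linear_fst])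
  show "time_rate h Z p > 0" for p using lift_nonzero by (simp add: time_rate_def)
  fix a J assume a: "orbit (- {Z}) (planar_kepler_U m Z) a J"
  then have J: "open_interval J" by (simp add: orbit_def)
  have "continuous_on J a"
    using a by (auto simp: orbit_planar_kepler intro!: continuous_at_imp_continuous_on differentiable_imp_continuous_within)
  then have "continuous_on J (\<lambda>t. (norm (lift h (a t - Z)))\<^sup>2)"
    unfolding lift_def
    by (intro continuous_intros bounded_linear.continuous_on[OF bounded_linear_tilt])
  from time_change_exists[OF J this] obtain t K where tK: "time_change t K J"
    "\<And>\<tau>. \<tau> \<in> K \<Longrightarrow> (t has_real_derivative (norm (lift h (a (t \<tau>) - Z)))\<^sup>2) (at \<tau>)"
    using lift_nonzero by auto
  then show "\<exists>t K. time_change t K J \<and>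
      orbit (open_hemisphere (zenith h) - {pole}) (spherical_kepler_U (m * (1 + h \<bullet> h)) pole) (project h Z \<circ> a \<circ> t) K \<and>
      (\<forall>\<tau>\<in>K. (t has_real_derivative time_rate h Z (a (t \<tau>), velocity a (t \<tau>))) (at \<tau>))"
    using spherical_orbit_of_planar[OF a tK] by (auto simp: time_rate_def)
next
  fix b K
  assume b: "orbit (open_hemisphere (zenith h) - {pole}) (spherical_kepler_U (m * (1 + h \<bullet> h)) pole) b K"
  then have K: "open_interval K" by (simp add: orbit_def)
  have b': "b differentiable (at \<tau>)" "normal h \<bullet> b \<tau> > 0" if "\<tau> \<in> K" for \<tau>
    using b that by (auto simp: orbit_def obeys_motion_def open_hemisphere_zenith)
  have "continuous_on K b"
    using b'(1) by (auto intro!: continuous_at_imp_continuous_on differentiable_imp_continuous_within)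
  then have "continuous_on K (\<lambda>\<tau>. ((normal h \<bullet> b \<tau>) / (1 + h \<bullet> h))\<^sup>2)"
    using one_plus_inner_self_pos[of h] by (intro continuous_intros) auto
  from time_change_exists[OF K this] obtain s J where "time_change s J K"
    "\<And>t. t \<in> J \<Longrightarrow> (s has_real_derivative ((normal h \<bullet> b (s t)) / (1 + h \<bullet> h))\<^sup>2) (at t)"
    using b'(2) one_plus_inner_self_pos[of h] by (force simp: zero_less_power2)
  then show "\<exists>s J. time_change s J K \<and>
      orbit (- {Z}) (planar_kepler_U m Z) (inv_into (- {Z}) (project h Z) \<circ> b \<circ> s) J"
    using planar_orbit_of_spherical[OF b] by blast
qed


section \<open>Conserved quantities\<close>

definition wedge :: "real^2 \<Rightarrow> real^2 \<Rightarrow> real" where "wedge x y = x $ 1 * y $ 2 - x $ 2 * y $ 1"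

text \<open>This is \<open>G\<close>, with \<open>C = wedge (q - Z) v\<close> and
  \<open>A = C (v\<^sub>2, - v\<^sub>1) - m (q - Z) / \<bar>q - Z\<bar>\<close>.\<close>

definition tilt_integral :: "real \<Rightarrow> real^2 \<Rightarrow> real^2 \<Rightarrow> (real^2) \<times> (real^2) \<Rightarrow> real" where
  "tilt_integral m Z h = (\<lambda>(q, v). (wedge (q - Z) v)\<^sup>2 / 2 - wedge (q - Z) v * wedge h v
     + m * (h \<bullet> (q - Z)) / norm (q - Z))"

text \<open>One family for both integrals: \<open>(\<alpha>, \<beta>) = (1, 0)\<close> is the planar
  energy, and \<open>((1 + h \<bullet> h)^2, 1 + h \<bullet> h)\<close> the spherical one.
  Conservation is proved once.\<close>

definition energy_pencil ::
    "real \<Rightarrow> real \<Rightarrow> real \<Rightarrow> real^2 \<Rightarrow> real^2 \<Rightarrow> (real^2) \<times> (real^2) \<Rightarrow> real" where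
  "energy_pencil \<alpha> \<beta> m Z h p =
     \<alpha> * mech_energy (planar_kepler_U m Z) p + \<beta> * tilt_integral m Z h p"

text \<open>A Gram determinant, the squared length of the cross product of lifted position and
  velocity. After the time change by \<open>|y|^2\<close> it is the squared spherical speed.\<close>

lemma norm_project_velocity:
  "(norm (lift h x))\<^sup>2 * (norm (tilt h v))\<^sup>2 - (lift h x \<bullet> tilt h v)\<^sup>2 =
    (1 + h \<bullet> h)\<^sup>2 * (v \<bullet> v) + (1 + h \<bullet> h) * ((wedge x v)\<^sup>2 - 2 * wedge x v * wedge h v)"
proof -
  have 1: "(norm (tilt h v))\<^sup>2 = v \<bullet> v + (h \<bullet> v)\<^sup>2"
    unfolding power2_norm_eq_inner
    by (simp add: tilt_def inner_diff_left inner_diff_right power2_eq_square)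
  have 2: "lift h x \<bullet> tilt h v = x \<bullet> v - (1 + h \<bullet> h - h \<bullet> x) * (h \<bullet> v)"
    by (simp add: lift_def tilt_def inner_diff_left inner_diff_right inner_add_left algebra_simps)
  show ?thesis unfolding norm_lift 1 2 inner_2 wedge_def by algebra
qed

lemma has_derivative_project:
  "(project h Z has_derivative (\<lambda>v. (1 / norm (lift h (q - Z))) *\<^sub>R tilt h v
      - ((lift h (q - Z) \<bullet> tilt h v) / norm (lift h (q - Z)) ^ 3) *\<^sub>R lift h (q - Z))) (at q)"
proof -
  have pos: "norm (lift h (q - Z)) > 0" using lift_nonzero by simp
  have l: "((\<lambda>q. lift h (q - Z)) has_derivative tilt h) (at q)"
    unfolding lift_def
    by (rule derivative_eq_intros bounded_linear.has_derivative[OF bounded_linear_tilt] refl)+ simp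
  have n: "((\<lambda>q. norm (lift h (q - Z))) has_derivative
      (\<lambda>v. (lift h (q - Z) \<bullet> tilt h v) / norm (lift h (q - Z)))) (at q)"
    using has_derivative_compose[OF l has_derivative_norm[OF lift_nonzero]]
    by (simp add: sgn_div_norm divide_inverse mult.commute inner_commute)
  have i: "((\<lambda>q. inverse (norm (lift h (q - Z)))) has_derivative
      (\<lambda>v. - ((lift h (q - Z) \<bullet> tilt h v) / norm (lift h (q - Z)) ^ 3))) (at q)"
    using Deriv.has_derivative_inverse[OF _ n] pos by (simp add: divide_inverse power3_eq_cube mult_ac)
  show ?thesis
    unfolding project_def[abs_def]
    using has_derivative_scaleR[OF i l] by (simp add: divide_inverse algebra_simps)
qed

lemma transported_energy_project:
  "transported_energy (spherical_kepler_U (m * (1 + h \<bullet> h)) pole) (project h Z) (time_rate h Z) =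
    energy_pencil ((1 + h \<bullet> h)\<^sup>2) (1 + h \<bullet> h) m Z h"
proof (rule ext, clarify)
  fix q v :: "real^2"
  define d x r l w where "d = 1 + h \<bullet> h" and "x = q - Z" and "r = norm (lift h x)" and "l = lift h x" and "w = tilt h v"
  have rpos: "r > 0" using lift_nonzero by (simp add: r_def)
  have ll: "l \<bullet> l = r\<^sup>2" by (simp add: l_def r_def power2_norm_eq_inner)
  have "r\<^sup>2 *\<^sub>R frechet_derivative (project h Z) (at q) v = r *\<^sub>R w - ((l \<bullet> w) / r) *\<^sub>R l"
    unfolding frechet_derivative_at[OF has_derivative_project, symmetric] x_def[symmetric]
      l_def[symmetric] w_def[symmetric] r_def[symmetric, folded l_def]
    using rpos by (simp add: scaleR_diff_right power2_eq_square power3_eq_cube)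
  moreover have "(r *\<^sub>R w - ((l \<bullet> w) / r) *\<^sub>R l) \<bullet> (r *\<^sub>R w - ((l \<bullet> w) / r) *\<^sub>R l) =
      r\<^sup>2 * (w \<bullet> w) - (l \<bullet> w)\<^sup>2"
    using rpos by (simp add: inner_diff_left inner_diff_right ll inner_commute[of w l] power2_eq_square field_simps)
  ultimately have kin: "(r\<^sup>2 *\<^sub>R frechet_derivative (project h Z) (at q) v) \<bullet>
      (r\<^sup>2 *\<^sub>R frechet_derivative (project h Z) (at q) v) =
      (1 + h \<bullet> h)\<^sup>2 * (v \<bullet> v) + (1 + h \<bullet> h) * ((wedge x v)\<^sup>2 - 2 * wedge x v * wedge h v)"
    using norm_project_velocity[of h x v] by (simp add: r_def l_def w_def power2_norm_eq_inner)
  define u where "u = project h Z q"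
  have un: "norm u = 1" using project_in_hemisphere[of h Z q] by (simp add: u_def open_hemisphere_def)
  have "\<bar>u \<bullet> pole\<bar> \<le> 1" using Cauchy_Schwarz_ineq2[of u pole] un by simp
  then have "sin (arccos (u \<bullet> pole)) = sqrt (1 - (u \<bullet> pole)\<^sup>2)" "cos (arccos (u \<bullet> pole)) = u \<bullet> pole"
    by (auto intro!: sin_arccos cos_arccos simp: abs_le_iff)
  moreover have "sqrt (1 - (u \<bullet> pole)\<^sup>2) = norm x / r"
    using norm_plane_part_unit[OF un] rpos
    by (simp add: u_def project_def linear_scale[OF linear_plane_part] x_def[symmetric] r_def)
  moreover have "u \<bullet> pole = (1 + h \<bullet> h - h \<bullet> x) / r"
    by (simp add: u_def project_def lift_inner_pole x_def r_def)
  \<comment> \<open>Height over horizontal distance of the lifted point; the normalising factor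
    \<open>r\<close> cancels.\<close>
  ultimately have cot: "cot (arccos (u \<bullet> pole)) = (d - h \<bullet> x) / norm x"
    using rpos by (simp add: cot_def d_def)
  have "transported_energy (spherical_kepler_U (m * d) pole) (project h Z) (time_rate h Z) (q, v) =
      (d\<^sup>2 * (v \<bullet> v) + d * ((wedge x v)\<^sup>2 - 2 * wedge x v * wedge h v)) / 2 - m * d * ((d - h \<bullet> x) / norm x)"
    unfolding kin[folded d_def, symmetric] cot[symmetric]
    by (simp add: transported_energy_def mech_energy_def time_rate_def spherical_kepler_U_def x_def r_def u_def)
  also have "\<dots> = energy_pencil (d\<^sup>2) d m Z h (q, v)"
    unfolding energy_pencil_def tilt_integral_def mech_energy_def planar_kepler_U_def case_prod_conv x_def[symmetric]
    by (simp add: add_divide_distrib diff_divide_distrib power2_eq_square algebra_simps)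
  finally show "transported_energy (spherical_kepler_U (m * (1 + h \<bullet> h)) pole) (project h Z) (time_rate h Z) (q, v) =
      energy_pencil ((1 + h \<bullet> h)\<^sup>2) (1 + h \<bullet> h) m Z h (q, v)"
    by (simp only: d_def)
qed

lemma has_real_derivative_wedge:
  assumes "(f has_vector_derivative f') (at t)" "(g has_vector_derivative g') (at t)"
  shows "((\<lambda>t. wedge (f t) (g t)) has_real_derivative wedge (f t) g' + wedge f' (g t)) (at t)"
proof -
  have "((\<lambda>t. f t $ i) has_real_derivative f' $ i) (at t)" "((\<lambda>t. g t $ i) has_real_derivative g' $ i) (at t)" for i
    using assms bounded_linear.has_vector_derivative[OF bounded_linear_vec_nth]
    by (auto simp: has_real_derivative_iff_has_vector_derivative)
  note d = this
  show ?thesis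
    unfolding wedge_def by (rule derivative_eq_intros d refl)+ (simp add: algebra_simps)
qed

text \<open>Energy, angular momentum and the component of the Laplace vector along \<open>h\<close>
  are each conserved.\<close>

lemma energy_pencil_constant_on_orbit:
  assumes "orbit (- {Z}) (planar_kepler_U m Z) q J"
  shows "(\<lambda>t. energy_pencil \<alpha> \<beta> m Z h (q t, velocity q t)) constant_on J"
proof -
  have J: "open_interval J" and q: "\<And>t. t \<in> J \<Longrightarrow> q t \<noteq> Z" "\<And>t. t \<in> J \<Longrightarrow> q differentiable (at t)"
    "\<And>t. t \<in> J \<Longrightarrow> velocity q differentiable (at t)"
    "\<And>t. t \<in> J \<Longrightarrow> velocity (velocity q) t = - (m / norm (q t - Z) ^ 3) *\<^sub>R (q t - Z)"
    using assms by (auto simp: orbit_planar_kepler)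
  have "((\<lambda>t. energy_pencil \<alpha> \<beta> m Z h (q t, velocity q t)) has_real_derivative 0) (at t)" if t: "t \<in> J" for t
  proof -
    define x v c where "x = q t - Z" and "v = velocity q t" and "c = m / norm x ^ 3"
    have xn: "norm x > 0" using q(1)[OF t] by (simp add: x_def)
    have dx: "((\<lambda>t. q t - Z) has_vector_derivative v) (at t)"
      using has_vector_derivative_velocity[OF q(2)[OF t]] by (auto intro!: derivative_eq_intros simp: v_def)
    have dv: "(velocity q has_vector_derivative - c *\<^sub>R x) (at t)"
      using has_vector_derivative_velocity[OF q(3)[OF t]] q(4)[OF t] by (simp add: c_def x_def)
    have dn: "((\<lambda>t. norm (q t - Z)) has_real_derivative (x \<bullet> v) / norm x) (at t)"
      using DERIV_chain2[OF DERIV_real_sqrt has_real_derivative_inner[OF dx dx]] xn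
      by (simp add: norm_eq_sqrt_inner x_def[symmetric] inner_commute field_simps)
    have dK: "((\<lambda>t. planar_kepler_U m Z (q t)) has_real_derivative - c * (x \<bullet> v)) (at t)"
      unfolding planar_kepler_U_def using DERIV_divide[OF DERIV_const dn, of m] xn
      by (simp add: x_def[symmetric] c_def field_simps power3_eq_cube)
    have dE: "((\<lambda>t. mech_energy (planar_kepler_U m Z) (q t, velocity q t)) has_real_derivative 0) (at t)"
      using DERIV_diff[OF DERIV_cdivide[OF has_real_derivative_inner[OF dv dv], of 2] dK]
      by (simp add: mech_energy_def v_def[symmetric] inner_commute)
    \<comment> \<open>The planar form of the triple product expansion; it makes the derivative of
      \<open>m (h \<bullet> x) / |x|\<close> cancel that of \<open>- C * wedge h v\<close>.\<close>
    have id: "(h \<bullet> v) * (norm x)\<^sup>2 - (h \<bullet> x) * (x \<bullet> v) = wedge x v * wedge x h"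
      unfolding power2_norm_eq_inner inner_2 wedge_def by algebra
    have w: "wedge x x = 0" "wedge v v = 0" "wedge h x = - wedge x h" by (simp_all add: wedge_def)
    have ws: "wedge y (- c *\<^sub>R x) = - c * wedge y x" for y by (simp add: wedge_def algebra_simps)
    have dC: "((\<lambda>t. wedge (q t - Z) (velocity q t)) has_real_derivative 0) (at t)"
      using has_real_derivative_wedge[OF dx dv] by (simp add: x_def[symmetric] v_def[symmetric] w ws del: scaleR_minus_left)
    have dH: "((\<lambda>t. wedge h (velocity q t)) has_real_derivative c * wedge x h) (at t)"
      using has_real_derivative_wedge[OF has_vector_derivative_const[of h] dv]
      by (simp add: w ws wedge_def[of 0] del: scaleR_minus_left)
    have dh: "((\<lambda>t. h \<bullet> (q t - Z)) has_real_derivative h \<bullet> v) (at t)"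
      using has_real_derivative_inner[OF has_vector_derivative_const[of h] dx] by simp
    have "((\<lambda>t. m * (h \<bullet> (q t - Z)) / norm (q t - Z)) has_real_derivative
        (m * (h \<bullet> v) * norm x - m * (h \<bullet> x) * ((x \<bullet> v) / norm x)) / (norm x * norm x)) (at t)"
      using DERIV_divide[OF DERIV_cmult[OF dh, of m] dn] xn by (simp add: x_def[symmetric])
    also have "(m * (h \<bullet> v) * norm x - m * (h \<bullet> x) * ((x \<bullet> v) / norm x)) / (norm x * norm x) =
        c * ((h \<bullet> v) * (norm x)\<^sup>2 - (h \<bullet> x) * (x \<bullet> v))"
      using xn by (simp add: c_def field_simps power2_eq_square power3_eq_cube)
    also note id
    finally have dU: "((\<lambda>t. m * (h \<bullet> (q t - Z)) / norm (q t - Z)) has_real_derivative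
        c * (wedge x v * wedge x h)) (at t)" .
    have dG: "((\<lambda>t. tilt_integral m Z h (q t, velocity q t)) has_real_derivative 0) (at t)"
      using DERIV_add[OF DERIV_diff[OF DERIV_cdivide[OF DERIV_power[OF dC, of 2], of 2] DERIV_mult[OF dC dH]] dU]
      by (simp add: tilt_integral_def x_def v_def)
    show ?thesis unfolding energy_pencil_def by (rule derivative_eq_intros dE dG refl)+ simp
  qed
  then have "\<exists>c. \<forall>t\<in>J. energy_pencil \<alpha> \<beta> m Z h (q t, velocity q t) = c"
    using J by (intro has_field_derivative_zero_constant)
       (auto simp: open_interval_def is_interval_convex intro: has_field_derivative_at_within)
  then show ?thesis by (simp add: constant_on_def)
qed

section \<open>Invariance under reflection at the wall\<close>

lemma wedge_reflect: "n \<noteq> 0 \<Longrightarrow> wedge x (reflect n v) = wedge x v - 2 * (v \<bullet> n) / (n \<bullet> n) * wedge x n"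
  by (simp add: reflect_def wedge_def algebra_simps)

lemma inner_reflect_self: "reflect n v \<bullet> reflect n v = v \<bullet> v"
  by (cases "n = 0") (simp_all add: reflect_def inner_diff_left inner_diff_right inner_commute field_simps)

text \<open>Completing the square, \<open>C^2 / 2 - C * wedge h v\<close> is half of
  \<open>(wedge (x - h) v)^2 - (wedge h v)^2\<close>. As \<open>x - h\<close> is tangent to the
  wall, the first wedge sees only the normal velocity and changes sign; as \<open>h\<close> is
  normal, the second sees only the tangential velocity.\<close>

lemma energy_pencil_reflect_line:
  assumes n: "n \<noteq> 0" and h: "h = ((n \<bullet> (p - Z)) / (n \<bullet> n)) *\<^sub>R n"
  shows "energy_pencil \<alpha> \<beta> m Z h (p, reflect n v) = energy_pencil \<alpha> \<beta> m Z h (p, v)"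
proof -
  define x s where "x = p - Z" and "s = (v \<bullet> n) / (n \<bullet> n)"
  have nn: "n \<bullet> n \<noteq> 0" using n by simp
  have wx: "wedge x (reflect n v) = wedge x v - 2 * s * wedge x n"
    using wedge_reflect[OF n] by (simp add: s_def)
  have "wedge h n = 0" by (simp add: h wedge_def)
  then have wh: "wedge h (reflect n v) = wedge h v" using wedge_reflect[OF n] by simp
  have "(n \<bullet> n) * wedge x v = (v \<bullet> n) * wedge x n + (n \<bullet> x) * wedge n v"
    unfolding inner_2 wedge_def by algebra
  moreover have "wedge h v = (n \<bullet> x) / (n \<bullet> n) * wedge n v"
    by (simp add: h x_def wedge_def algebra_simps)
  ultimately have "wedge x v = s * wedge x n + wedge h v"
    using nn by (simp add: s_def field_simps)
  then have "(wedge x v - 2 * s * wedge x n)\<^sup>2 / 2 - (wedge x v - 2 * s * wedge x n) * wedge h v =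
      (wedge x v)\<^sup>2 / 2 - wedge x v * wedge h v"
    by (simp add: power2_eq_square field_simps)
  then show ?thesis
    by (simp add: energy_pencil_def tilt_integral_def mech_energy_def inner_reflect_self x_def[symmetric] wx wh)
qed

text \<open>For \<open>h = 0\<close> the tilt integral is \<open>C^2 / 2\<close>, and a radial
  change of velocity does not affect \<open>C\<close>.\<close>

lemma energy_pencil_reflect_circle:
  assumes "p \<noteq> Z"
  shows "energy_pencil \<alpha> \<beta> m Z 0 (p, reflect (p - Z) v) = energy_pencil \<alpha> \<beta> m Z 0 (p, v)"
  using assms
  by (simp add: energy_pencil_def tilt_integral_def mech_energy_def inner_reflect_self wedge_reflect)
     (simp add: wedge_def)

lemma kepler_table_tilt:
  assumes "kepler_table Z W \<nu> \<Omega>"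
  obtains h where "open \<Omega>"
    "\<And>p v \<alpha> \<beta> m. p \<in> W - {Z} \<Longrightarrow> energy_pencil \<alpha> \<beta> m Z h (p, reflect (\<nu> p) v) = energy_pencil \<alpha> \<beta> m Z h (p, v)"
  using assms
proof cases
  case (line_below n c)
  show ?thesis
    \<comment> \<open>The foot of the perpendicular from \<open>Z\<close>, relative to
      \<open>Z\<close>: the same vector for all points of the wall, and zero if \<open>Z\<close>
      lies on it.\<close>
    by (rule that[of "((c - n \<bullet> Z) / (n \<bullet> n)) *\<^sub>R n"])
       (auto simp: line_below open_halfspace_lt inner_diff_right intro!: energy_pencil_reflect_line)
next
  case (line_above n c)
  show ?thesis
    by (rule that[of "((c - n \<bullet> Z) / (n \<bullet> n)) *\<^sub>R n"])
       (auto simp: line_above open_halfspace_gt inner_diff_right intro!: energy_pencil_reflect_line)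
qed (auto intro!: that[of 0] energy_pencil_reflect_circle)

section \<open>Constancy along whole billiard trajectories\<close>

lemma continuous_energy_pencil:
  assumes "p \<noteq> Z"
  shows "isCont (energy_pencil \<alpha> \<beta> m Z h) (p, v)"
  using assms
  unfolding energy_pencil_def[abs_def] tilt_integral_def mech_energy_def planar_kepler_U_def wedge_def case_prod_beta
  by (intro continuous_intros) auto

lemma wedge_scaleR [simp]: "wedge (r *\<^sub>R x) y = r * wedge x y"
  by (simp add: wedge_def algebra_simps)

text \<open>\<open>collision_bounce\<close> fixes position on a ray and energy, but not the
  direction of the velocity. Differentiability makes the velocity parallel to \<open>e\<close>;
  hence \<open>C = 0\<close> and the tilt integral is \<open>m * (h \<bullet> e)\<close>, the same
  before and after.\<close>

lemma energy_pencil_collision: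
  assumes "collision_bounce m Z q t" "\<forall>\<^sub>F s in at t. q differentiable (at s)"
  shows "\<exists>c. \<forall>\<^sub>F s in at t. energy_pencil \<alpha> \<beta> m Z h (q s, velocity q s) = c"
proof -
  obtain e k where e: "norm e = 1"
    and ev: "\<forall>\<^sub>F s in at t. (\<exists>r>0. q s = Z + r *\<^sub>R e) \<and>
          mech_energy (planar_kepler_U m Z) (q s, velocity q s) = k"
    using assms(1) by (auto simp: collision_bounce_def)
  obtain S where S: "open S" "t \<in> S" "\<And>s. s \<in> S - {t} \<Longrightarrow> (\<exists>r>0. q s = Z + r *\<^sub>R e) \<and>
      mech_energy (planar_kepler_U m Z) (q s, velocity q s) = k \<and> q differentiable (at s)"
    using eventually_conj[OF ev assms(2)] by (auto simp: eventually_at_topological)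
  have S': "open (S - {t})" using S(1) by (simp add: open_delete)
  have "energy_pencil \<alpha> \<beta> m Z h (q s, velocity q s) = \<alpha> * k + \<beta> * (m * (h \<bullet> e))" if s: "s \<in> S - {t}" for s
  proof -
    obtain r where r: "r > 0" "q s = Z + r *\<^sub>R e" using S(3)[OF s] by blast
    have "((\<lambda>s. q s - Z) has_vector_derivative velocity q s) (at s)"
      using has_vector_derivative_velocity[of q s] S(3)[OF s] by (auto intro!: derivative_eq_intros)
    from has_real_derivative_wedge[OF has_vector_derivative_const[of e] this]
    have "((\<lambda>s. wedge e (q s - Z)) has_real_derivative wedge e (velocity q s)) (at s)"
      by (simp add: wedge_def)
    moreover have "((\<lambda>s. wedge e (q s - Z)) has_real_derivative 0) (at s)"
    proof (rule has_field_derivative_transform_within_open[OF DERIV_const S' s])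
      fix s' assume "s' \<in> S - {t}"
      then obtain r where "q s' = Z + r *\<^sub>R e" using S(3) by blast
      then show "0 = wedge e (q s' - Z)" by (simp add: wedge_def)
    qed
    ultimately have "wedge e (velocity q s) = 0" using DERIV_unique by blast
    then show ?thesis using S(3)[OF s] r e by (simp add: energy_pencil_def tilt_integral_def)
  qed
  then show ?thesis using S(1,2) by (auto simp: eventually_at_topological)
qed

text \<open>By continuity away from \<open>Z\<close>, \<open>c1\<close> and \<open>c2\<close> are
  the values at the incoming and the outgoing limit velocity.\<close>

lemma energy_pencil_wall_reflection:
  assumes q: "isCont q t" and w: "wall_reflection (W - {Z}) \<nu> q t"
    and refl: "\<And>v. energy_pencil \<alpha> \<beta> m Z h (q t, reflect (\<nu> (q t)) v) = energy_pencil \<alpha> \<beta> m Z h (q t, v)"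
    and l: "\<forall>\<^sub>F s in at_left t. energy_pencil \<alpha> \<beta> m Z h (q s, velocity q s) = c1"
    and r: "\<forall>\<^sub>F s in at_right t. energy_pencil \<alpha> \<beta> m Z h (q s, velocity q s) = c2"
  shows "c1 = c2"
proof -
  obtain v where qZ: "q t \<noteq> Z" and v: "(velocity q \<longlongrightarrow> v) (at_left t)"
    "(velocity q \<longlongrightarrow> reflect (\<nu> (q t)) v) (at_right t)"
    using w by (auto simp: wall_reflection_def)
  have lim: "((\<lambda>s. energy_pencil \<alpha> \<beta> m Z h (q s, velocity q s)) \<longlongrightarrow> energy_pencil \<alpha> \<beta> m Z h (q t, w)) F"
    if "(velocity q \<longlongrightarrow> w) F" "F \<le> at t" for w F
    using isCont_tendsto_compose[OF continuous_energy_pencil[OF qZ]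
        tendsto_Pair[OF tendsto_mono[OF that(2) isContD[OF q]] that(1)]] .
  have "c1 = energy_pencil \<alpha> \<beta> m Z h (q t, v)"
    using tendsto_unique[OF trivial_limit_at_left_real tendsto_eventually[OF l] lim[OF v(1)]]
    by (simp add: at_le)
  moreover have "c2 = energy_pencil \<alpha> \<beta> m Z h (q t, reflect (\<nu> (q t)) v)"
    using tendsto_unique[OF trivial_limit_at_right_real tendsto_eventually[OF r] lim[OF v(2)]]
    by (simp add: at_le)
  ultimately show ?thesis using refl by simp
qed

text \<open>\<open>J - T\<close> is usually disconnected. The value \<open>g t\<close> of
  \<open>F\<close> on a punctured neighbourhood of \<open>t\<close> is defined on all of
  \<open>J\<close>, including \<open>T\<close>, and is locally constant on this connected
  set.\<close>

lemma constant_on_minus_sparse: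
  fixes F :: "real \<Rightarrow> 'a"
  assumes J: "open_interval J"
    and ev: "\<And>t. t \<in> J \<Longrightarrow> \<exists>c. \<forall>\<^sub>F s in at t. F s = c"
    and at: "\<And>t. t \<in> J - T \<Longrightarrow> \<forall>\<^sub>F s in at t. F s = F t"
  shows "F constant_on (J - T)"
proof -
  obtain g where g: "\<And>t. t \<in> J \<Longrightarrow> \<forall>\<^sub>F s in at t. F s = g t" using ev by metis
  have unique: "c = g t" if "t \<in> J" "\<forall>\<^sub>F s in at t. F s = c" for t c
  proof -
    have "\<forall>\<^sub>F s in at t. c = g t" using g[OF that(1)] that(2) by eventually_elim simp
    then show ?thesis by (simp add: eventually_const_iff)
  qed
  have "g constant_on J"
  proof (rule locally_constant_imp_constant)
    show "connected J" using J by (rule open_interval_connected)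
    fix t assume t: "t \<in> J"
    obtain S where S: "open S" "t \<in> S" "\<And>s. s \<in> S - {t} \<Longrightarrow> F s = g t"
      using g[OF t] by (auto simp: eventually_at_topological)
    have loc: "g s = g t" if "s \<in> J \<inter> S" for s
    proof (cases "s = t")
      case False
      have "\<forall>\<^sub>F s' in at s. s' \<in> S - {t}"
        using S(1) that False by (intro eventually_at_in_open') (auto simp: open_delete)
      then have "\<forall>\<^sub>F s' in at s. F s' = g t" by (rule eventually_mono) (rule S(3))
      then show ?thesis using unique[of s "g t"] that by simp
    qed simp
    then show "\<exists>S. openin (top_of_set J) S \<and> t \<in> S \<and> (\<forall>s\<in>S. g s = g t)"
      using S(2) t by (intro exI[of _ "J \<inter> S"] conjI ballI openin_open_Int[OF S(1)] loc) simp_all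
  qed
  moreover have "F t = g t" if "t \<in> J - T" for t using unique at that by auto
  ultimately show ?thesis unfolding constant_on_def by auto
qed

lemma energy_pencil_constant_on_billiard:
  assumes traj: "billiard_trajectory m Z W \<nu> \<Omega> q J T" and \<Omega>: "open \<Omega>"
    and refl: "\<And>p v. p \<in> W - {Z} \<Longrightarrow> energy_pencil \<alpha> \<beta> m Z h (p, reflect (\<nu> p) v) = energy_pencil \<alpha> \<beta> m Z h (p, v)"
  shows "(\<lambda>t. energy_pencil \<alpha> \<beta> m Z h (q t, velocity q t)) constant_on (J - T)"
proof -
  define F where "F t = energy_pencil \<alpha> \<beta> m Z h (q t, velocity q t)" for t
  have J: "open_interval J" "open J" and T: "T sparse_in J" and cont: "continuous_on J q"
    and mo: "\<And>t. t \<in> J - T \<Longrightarrow> obeys_motion (\<Omega> - {Z}) (planar_kepler_U m Z) q t"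
    and ev: "\<And>t. t \<in> T \<Longrightarrow> wall_reflection (W - {Z}) \<nu> q t \<or> collision_bounce m Z q t"
    using traj by (auto simp: billiard_trajectory_def open_interval_def)
  have mo': "q t \<noteq> Z \<and> q differentiable (at t) \<and> velocity q differentiable (at t) \<and>
    velocity (velocity q) t = - (m / norm (q t - Z) ^ 3) *\<^sub>R (q t - Z)" if "t \<in> J - T" for t
    using mo[OF that] obeys_motion_planar_kepler[of "\<Omega> - {Z}" Z m q t] \<Omega> by (auto simp: open_delete)
  have seg: "F constant_on {a<..<b}" if "a < b" "{a<..<b} \<subseteq> J - T" for a b
    unfolding F_def
    by (rule energy_pencil_constant_on_orbit)
       (use that mo' in \<open>auto simp: orbit_planar_kepler open_interval_def is_interval_convex_1\<close>)
  \<comment> \<open>Event times do not accumulate in \<open>J\<close>, so every time is isolated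
    from all other events.\<close>
  have punct: "\<exists>\<epsilon>>0. \<forall>s. s \<noteq> t \<and> dist s t < \<epsilon> \<longrightarrow> s \<in> J - T" if t: "t \<in> J" for t
  proof -
    have "\<not> t islimpt T" using T t by (auto simp: sparse_in_def)
    then have "\<forall>\<^sub>F s in at t. s \<notin> T" by (simp add: islimpt_iff_eventually)
    moreover have "\<forall>\<^sub>F s in at t. s \<in> J" using J(2) t by (rule eventually_at_in_open')
    ultimately have "\<forall>\<^sub>F s in at t. s \<in> J - T" by eventually_elim simp
    then show ?thesis by (simp add: eventually_at)
  qed
  have "F constant_on (J - T)"
  proof (rule constant_on_minus_sparse[OF J(1)])
    show at: "\<forall>\<^sub>F s in at t. F s = F t" if t: "t \<in> J - T" for t
    proof -
      obtain \<epsilon> where \<epsilon>: "\<epsilon> > 0" "\<And>s. s \<noteq> t \<Longrightarrow> dist s t < \<epsilon> \<Longrightarrow> s \<in> J - T" using punct t by blast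
      have "{t-\<epsilon><..<t+\<epsilon>} \<subseteq> J - T"
      proof
        fix s assume "s \<in> {t-\<epsilon><..<t+\<epsilon>}"
        then have "dist s t < \<epsilon>" by (auto simp: dist_real_def abs_less_iff)
        then show "s \<in> J - T" using \<epsilon>(2)[of s] t by (cases "s = t") auto
      qed
      then have "F constant_on {t-\<epsilon><..<t+\<epsilon>}" using seg \<epsilon>(1) by simp
      then obtain c where c: "\<And>s. s \<in> {t-\<epsilon><..<t+\<epsilon>} \<Longrightarrow> F s = c" by (auto simp: constant_on_def)
      have "F t = c" using c \<epsilon>(1) by simp
      have "\<forall>\<^sub>F s in at t. s \<in> {t-\<epsilon><..<t+\<epsilon>}"
        using \<epsilon>(1) by (intro eventually_at_in_open') auto
      then show ?thesis unfolding \<open>F t = c\<close> by (rule eventually_mono) (rule c)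
    qed
    show "\<exists>c. \<forall>\<^sub>F s in at t. F s = c" if t: "t \<in> J" for t
    proof (cases "t \<in> T")
      case False
      then show ?thesis using at t by blast
    next
      case True
      obtain \<epsilon> where \<epsilon>: "\<epsilon> > 0" "\<And>s. s \<noteq> t \<Longrightarrow> dist s t < \<epsilon> \<Longrightarrow> s \<in> J - T" using punct t by blast
      from ev[OF True] show ?thesis
      proof
        assume "collision_bounce m Z q t"
        moreover have "\<forall>\<^sub>F s in at t. q differentiable (at s)"
          using \<epsilon> mo' unfolding eventually_at by blast
        ultimately show ?thesis unfolding F_def by (rule energy_pencil_collision)
      next
        assume w: "wall_reflection (W - {Z}) \<nu> q t"
        have "{t-\<epsilon><..<t} \<subseteq> J - T" "{t<..<t+\<epsilon>} \<subseteq> J - T" using \<epsilon>(2) by (auto simp: dist_real_def)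
        then obtain c1 c2 where c: "\<And>s. s \<in> {t-\<epsilon><..<t} \<Longrightarrow> F s = c1" "\<And>s. s \<in> {t<..<t+\<epsilon>} \<Longrightarrow> F s = c2"
          using seg[of "t-\<epsilon>" t] seg[of t "t+\<epsilon>"] \<epsilon>(1) by (auto simp: constant_on_def)
        have l: "\<forall>\<^sub>F s in at_left t. F s = c1"
          using eventually_at_left_real[of "t-\<epsilon>" t] \<epsilon>(1) by (auto elim!: eventually_mono intro: c)
        have r: "\<forall>\<^sub>F s in at_right t. F s = c2"
          using eventually_at_right_real[of t "t+\<epsilon>"] \<epsilon>(1) by (auto elim!: eventually_mono intro: c)
        have "isCont q t" using cont J(2) t by (simp add: continuous_on_eq_continuous_at)
        moreover have "q t \<in> W - {Z}" using w by (simp add: wall_reflection_def)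
        ultimately have "c1 = c2"
          using energy_pencil_wall_reflection[OF _ w refl l[unfolded F_def] r[unfolded F_def]] by blast
        then show ?thesis using l r by (auto simp: eventually_at_split)
      qed
    qed
  qed
  then show ?thesis by (simp add: F_def[abs_def])
qed

lemma billiard_conserved_energy_pencil:
  assumes "open \<Omega>"
    and "\<And>p v. p \<in> W - {Z} \<Longrightarrow> energy_pencil \<alpha> \<beta> m Z h (p, reflect (\<nu> p) v) = energy_pencil \<alpha> \<beta> m Z h (p, v)"
  shows "billiard_conserved m Z W \<nu> \<Omega> (energy_pencil \<alpha> \<beta> m Z h)"
  unfolding billiard_conserved_def
  using assms energy_pencil_constant_on_orbit energy_pencil_constant_on_billiard by blast


section \<open>Functional independence\<close>

lemma elementary_on_imp_frechet_derivative_line: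
  assumes "elementary_on S F" "open S" "p \<in> S" "((\<lambda>s. F (p + s *\<^sub>R w)) has_real_derivative D) (at 0)"
  shows "frechet_derivative F (at p) w = D"
proof -
  have F: "(F has_derivative frechet_derivative F (at p)) (at (p + 0 *\<^sub>R w))"
    using frechet_derivative_works[THEN iffD1, OF elementary_onD(1)[OF assms(1-3)]] by simp
  have "((\<lambda>s::real. p + s *\<^sub>R w) has_derivative (\<lambda>s. s *\<^sub>R w)) (at 0)"
    by (auto intro!: derivative_eq_intros)
  from has_derivative_compose[OF this F]
  have "((\<lambda>s. F (p + s *\<^sub>R w)) has_derivative (\<lambda>s. frechet_derivative F (at p) (s *\<^sub>R w))) (at 0)" .
  from has_derivative_unique[OF this assms(4)[unfolded has_field_derivative_def]]
  show ?thesis by (metis mult.right_neutral scaleR_one)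
qed

lemma elementary_energy:
  "elementary_on ((- {Z}) \<times> UNIV) (mech_energy (planar_kepler_U m Z))"
  "elementary_on ((- {Z}) \<times> UNIV) (tilt_integral m Z h)"
proof -
  let ?S = "(- {Z}) \<times> (UNIV :: (real^2) set)"
  have q: "elementary_on ?S (\<lambda>p. (fst p - Z) $ i)" and v: "elementary_on ?S (\<lambda>p. snd p $ i)" for i
    unfolding vector_minus_component
    by (intro elementary_diff elementary_const elementary_linear bounded_linear_compose[OF bounded_linear_vec_nth]
        bounded_linear_fst bounded_linear_snd)+
  have i: "elementary_on ?S (\<lambda>p. inverse (norm (fst p - Z)))"
  proof -
    have "elementary_on ?S (\<lambda>p. (fst p - Z) \<bullet> (fst p - Z))"
      unfolding inner_2 by (intro elementary_add elementary_mult q)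
    then show ?thesis
      unfolding norm_eq_sqrt_inner by (intro elementary_inverse elementary_sqrt) auto
  qed
  show "elementary_on ?S (mech_energy (planar_kepler_U m Z))"
    unfolding mech_energy_def planar_kepler_U_def case_prod_beta divide_inverse inner_2
    by (intro elementary_diff elementary_add elementary_mult elementary_const v i)
  show "elementary_on ?S (tilt_integral m Z h)"
    unfolding tilt_integral_def wedge_def case_prod_beta divide_inverse inner_2 power2_eq_square
    by (intro elementary_diff elementary_add elementary_mult elementary_const q v i)
qed

text \<open>Velocity directions are enough for independence, and along them the position-dependent
  potential terms drop out.\<close>

lemma frechet_derivative_energy:
  assumes "q \<noteq> Z"
  shows "frechet_derivative (mech_energy (planar_kepler_U m Z)) (at (q, v)) (0, w) = v \<bullet> w"
    and "frechet_derivative (tilt_integral m Z h) (at (q, v)) (0, w) =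
      wedge (q - Z) v * wedge (q - Z) w - wedge (q - Z) w * wedge h v - wedge (q - Z) v * wedge h w"
proof -
  have S: "open ((- {Z}) \<times> (UNIV :: (real^2) set))" "(q, v) \<in> (- {Z}) \<times> UNIV"
    using assms by (auto intro: open_Times)
  have w: "wedge x (v + s *\<^sub>R w) = wedge x v + s * wedge x w" for x s
    by (simp add: wedge_def algebra_simps)
  show "frechet_derivative (mech_energy (planar_kepler_U m Z)) (at (q, v)) (0, w) = v \<bullet> w"
    by (rule elementary_on_imp_frechet_derivative_line[OF elementary_energy(1) S])
       (auto simp: mech_energy_def inner_add_left inner_add_right inner_commute intro!: derivative_eq_intros)
  show "frechet_derivative (tilt_integral m Z h) (at (q, v)) (0, w) =
      wedge (q - Z) v * wedge (q - Z) w - wedge (q - Z) w * wedge h v - wedge (q - Z) v * wedge h w"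
    by (rule elementary_on_imp_frechet_derivative_line[OF elementary_energy(2) S])
       (auto simp: tilt_integral_def w intro!: derivative_eq_intros)
qed

text \<open>Up to the factor \<open>v \<bullet> v\<close>, the minor of the differentials of \<open>E\<close> and \<open>G\<close> for the velocity
  directions \<open>v\<close> and \<open>v\<close> turned by a right angle.\<close>

definition minor :: "real^2 \<Rightarrow> real^2 \<Rightarrow> real^2 \<Rightarrow> real" where
  "minor h x v = (wedge x v - wedge h v) * (x \<bullet> v) - wedge x v * (h \<bullet> v)"

text \<open>Along \<open>v\<close> turned by a right angle the differential of the planar energy
  vanishes and that of the tilt integral is the minor, which gives \<open>b = 0\<close>. The
  direction \<open>v\<close> then gives \<open>a = 0\<close>.\<close>

lemma energies_independent_at:
  assumes q: "q \<noteq> Z" and minor: "minor h (q - Z) v \<noteq> 0" and "\<beta> \<noteq> 0"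
    and zero: "\<And>w. a * frechet_derivative (mech_energy (planar_kepler_U m Z)) (at (q, v)) w +
       b * frechet_derivative (energy_pencil \<alpha> \<beta> m Z h) (at (q, v)) w = 0"
  shows "a = 0 \<and> b = 0"
proof -
  have S: "open ((- {Z}) \<times> (UNIV :: (real^2) set))" "(q, v) \<in> (- {Z}) \<times> UNIV"
    using q by (auto intro: open_Times)
  define E G where "E = mech_energy (planar_kepler_U m Z)" and "G = tilt_integral m Z h"
  have d: "(E has_derivative frechet_derivative E (at (q, v))) (at (q, v))"
    "(G has_derivative frechet_derivative G (at (q, v))) (at (q, v))"
    unfolding E_def G_def
    by (intro frechet_derivative_works[THEN iffD1] elementary_onD(1)[OF _ S] elementary_energy)+
  have "(energy_pencil \<alpha> \<beta> m Z h has_derivative (\<lambda>w. \<alpha> * frechet_derivative E (at (q, v)) w +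
      \<beta> * frechet_derivative G (at (q, v)) w)) (at (q, v))"
    unfolding energy_pencil_def[abs_def] E_def[symmetric] G_def[symmetric]
    by (intro has_derivative_add has_derivative_mult_right d)
  note P = fun_cong[OF frechet_derivative_at[OF this]]
  define u where "u = (vector [- v $ 2, v $ 1] :: real^2)"
  have u: "v \<bullet> u = 0" "wedge x u = x \<bullet> v" for x
    by (simp_all add: u_def inner_2 wedge_def algebra_simps)
  have "a * frechet_derivative E (at (q, v)) (0, u) + b * (\<alpha> * frechet_derivative E (at (q, v)) (0, u) +
      \<beta> * frechet_derivative G (at (q, v)) (0, u)) = 0"
    using zero[of "(0, u)"] by (simp add: E_def P[symmetric])
  then have "b * (\<beta> * minor h (q - Z) v) = 0"
    unfolding E_def G_def frechet_derivative_energy[OF q] u minor_def by (simp add: algebra_simps)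
  then have b: "b = 0" using minor \<open>\<beta> \<noteq> 0\<close> by simp
  have "a * (v \<bullet> v) = 0"
    using zero[of "(0, v)"] b by (simp add: frechet_derivative_energy[OF q])
  moreover have "v \<noteq> 0" using minor by (auto simp: minor_def)
  ultimately show ?thesis using b by simp
qed

lemma minor_nonzero_exists: "\<exists>x v. minor h x v \<noteq> 0"
proof -
  \<comment> \<open>Chosen so that both factors of the resulting value
    \<open>c^3 * (c - 2 * h $ 1)\<close> are positive.\<close>
  define c where "c = 1 + 2 * \<bar>h $ 1\<bar>"
  have "c > 0" "c - 2 * h $ 1 > 0" by (auto simp: c_def)
  moreover have "minor h (vector [c, 0]) (vector [c, c]) = c ^ 3 * (c - 2 * h $ 1)"
    by (simp add: minor_def wedge_def inner_2 algebra_simps power3_eq_cube)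
  ultimately show ?thesis by (intro exI[of _ "vector [c, 0]"] exI[of _ "vector [c, c]"]) simp
qed

text \<open>Along a line through a point where the minor does not vanish, it is a nonzero polynomial.\<close>

lemma minor_nonzero_dense:
  assumes "open \<Omega>"
  shows "\<Omega> \<times> UNIV \<subseteq> closure {(q, v). q \<in> \<Omega> \<and> minor h (q - Z) v \<noteq> 0}"
proof clarify
  fix q v assume q: "q \<in> \<Omega>"
  obtain x' v' where nz: "minor h x' v' \<noteq> 0" using minor_nonzero_exists by blast
  define a b where "a = x' - (q - Z)" and "b = v' - v"
  define y where "y s = (q + s *\<^sub>R a, v + s *\<^sub>R b)" for s :: real
  define X V where "X i = [:(q - Z) $ i, a $ i:]" and "V i = [:v $ i, b $ i:]" for i
  define p where "p = ((X 1 * V 2 - X 2 * V 1) - ([:h $ 1:] * V 2 - [:h $ 2:] * V 1)) * (X 1 * V 1 + X 2 * V 2)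
     - (X 1 * V 2 - X 2 * V 1) * ([:h $ 1:] * V 1 + [:h $ 2:] * V 2)"
  have X: "poly (X i) s = (fst (y s) - Z) $ i" and V: "poly (V i) s = snd (y s) $ i" for i s
    by (simp_all add: X_def V_def y_def)
  have p: "poly p s = minor h (fst (y s) - Z) (snd (y s))" for s
    unfolding p_def minor_def wedge_def inner_2 poly_mult poly_add poly_diff X V by simp
  \<comment> \<open>The line runs from \<open>(q, v)\<close> at \<open>s = 0\<close> to
    \<open>(Z + x', v')\<close> at \<open>s = 1\<close>.\<close>
  have "poly p 1 \<noteq> 0" using nz unfolding p by (simp add: y_def a_def b_def)
  then have "p \<noteq> 0" by auto
  then have "finite {s. poly p s = 0}" by (rule poly_roots_finite)
  then have "\<not> 0 islimpt {s. poly p s = 0}" by (rule islimpt_finite)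
  then have 1: "\<forall>\<^sub>F s in at 0. poly p s \<noteq> 0" by (simp add: islimpt_iff_eventually)
  have y0: "(y \<longlongrightarrow> (q, v)) (at 0)"
    unfolding y_def by (auto intro!: tendsto_eq_intros)
  show "(q, v) \<in> closure {(q, v). q \<in> \<Omega> \<and> minor h (q - Z) v \<noteq> 0}"
  proof (rule Lim_in_closed_set[OF closed_closure _ _ y0])
    have "\<forall>\<^sub>F s in at 0. fst (y s) \<in> \<Omega>"
      using topological_tendstoD[OF tendsto_fst[OF y0] assms] q by simp
    with 1 show "\<forall>\<^sub>F s in at 0. y s \<in> closure {(q, v). q \<in> \<Omega> \<and> minor h (q - Z) v \<noteq> 0}"
      by eventually_elim (auto simp: p case_prod_beta intro!: subsetD[OF closure_subset])
  qed simp
qed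

lemma functionally_independent_energies:
  assumes "open \<Omega>" "\<beta> \<noteq> 0"
  shows "functionally_independent_on ((\<Omega> - {Z}) \<times> UNIV)
    (mech_energy (planar_kepler_U m Z)) (energy_pencil \<alpha> \<beta> m Z h)"
  unfolding functionally_independent_on_def
proof (intro exI conjI ballI allI impI)
  let ?D = "{(q, v). q \<in> \<Omega> - {Z} \<and> minor h (q - Z) v \<noteq> 0}"
  have \<Omega>: "open (\<Omega> - {Z})" using assms(1) by (rule open_delete)
  have "open {p. minor h (fst p - Z) (snd p) \<noteq> 0}"
    unfolding minor_def wedge_def by (intro open_Collect_neq continuous_intros)
  then have "open (((\<Omega> - {Z}) \<times> UNIV) \<inter> {p. minor h (fst p - Z) (snd p) \<noteq> 0})"
    using \<Omega> by (intro open_Int open_Times open_UNIV)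
  also have "((\<Omega> - {Z}) \<times> UNIV) \<inter> {p. minor h (fst p - Z) (snd p) \<noteq> 0} = ?D" by auto
  finally show "open ?D" .
  show "?D \<subseteq> (\<Omega> - {Z}) \<times> UNIV" by auto
  show "(\<Omega> - {Z}) \<times> UNIV \<subseteq> closure ?D" by (rule minor_nonzero_dense[OF \<Omega>])
  fix p assume p: "p \<in> ?D"
  have S: "open ((- {Z}) \<times> (UNIV :: (real^2) set))" "p \<in> (- {Z}) \<times> UNIV"
    using p by (auto intro: open_Times)
  show "mech_energy (planar_kepler_U m Z) differentiable (at p)"
    by (rule elementary_onD(1)[OF elementary_energy(1) S])
  show "energy_pencil \<alpha> \<beta> m Z h differentiable (at p)"
    unfolding energy_pencil_def[abs_def]
    by (rule elementary_onD(1)[OF _ S]) (intro elementary_add elementary_mult elementary_const elementary_energy)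
  fix a b assume z: "\<forall>w. a * frechet_derivative (mech_energy (planar_kepler_U m Z)) (at p) w +
       b * frechet_derivative (energy_pencil \<alpha> \<beta> m Z h) (at p) w = 0"
  show "a = 0" "b = 0"
    using energies_independent_at[of "fst p" Z h "snd p" \<beta> a m b \<alpha>] p z assms(2) by auto
qed

theorem theorem3p1:
  fixes m :: real and Z :: "real^2"
    and W \<Omega> :: "(real^2) set" and \<nu> :: "real^2 \<Rightarrow> real^2"
  assumes "m \<noteq> 0"
    and "kepler_table Z W \<nu> \<Omega>"
  shows "\<exists>(N :: real^3) (Z\<^sub>1 :: real^3) (m' :: real) (\<phi> :: real^2 \<Rightarrow> real^3)
           (f :: (real^2) \<times> (real^2) \<Rightarrow> real).
           norm N = 1 \<and> Z\<^sub>1 \<in> open_hemisphere N \<and> m' \<noteq> 0 \<and>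
           correspondence (- {Z}) (planar_kepler_U m Z)
             (open_hemisphere N - {Z\<^sub>1}) (spherical_kepler_U m' Z\<^sub>1) \<phi> f \<and>
           billiard_integrable_by m Z W \<nu> \<Omega>
             (mech_energy (planar_kepler_U m Z))
             (transported_energy (spherical_kepler_U m' Z\<^sub>1) \<phi> f)"
proof -
  obtain h where \<Omega>: "open \<Omega>" and refl: "\<And>p v \<alpha> \<beta>. p \<in> W - {Z} \<Longrightarrow>
      energy_pencil \<alpha> \<beta> m Z h (p, reflect (\<nu> p) v) = energy_pencil \<alpha> \<beta> m Z h (p, v)"
    using kepler_table_tilt[OF assms(2)] by metis
  have d: "1 + h \<bullet> h \<noteq> 0" using one_plus_inner_self_pos[of h] by simp
  have "energy_pencil 1 0 m Z h = mech_energy (planar_kepler_U m Z)"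
    by (simp add: energy_pencil_def fun_eq_iff)
  then have "billiard_integrable_by m Z W \<nu> \<Omega> (mech_energy (planar_kepler_U m Z))
      (transported_energy (spherical_kepler_U (m * (1 + h \<bullet> h)) pole) (project h Z) (time_rate h Z))"
    unfolding billiard_integrable_by_def transported_energy_project
    using billiard_conserved_energy_pencil[where W = W and \<nu> = \<nu>, OF \<Omega> refl]
      functionally_independent_energies[OF \<Omega> d] by metis
  then show ?thesis
    using assms(1) d norm_zenith pole_in_hemisphere correspondence_project
    by (intro exI[of _ "zenith h"] exI[of _ pole] exI[of _ "m * (1 + h \<bullet> h)"]
        exI[of _ "project h Z"] exI[of _ "time_rate h Z"]) auto
qed

end
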